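(* Let $K=K(n)$ be positive integers with $K\to\infty$ and $n/K\to 0$ as $n\to\infty$, and let the initial law $\mu_K$ of the walk $Y_K$ be the uniform law on $V_K$. Then for every $s\ge 1$, all $0\leq t_1<\dots<t_s$ and every smooth compactly supported function $\varphi\in\mathcal{C}_c^\infty(\mathbb{R}^s,\mathbb{R})$, \[\sqrt{2\pi\frac{K}{n}}\;\mathbb{E}\left[\varphi\left(Z_{n,K}(t_1),\Delta Z_{n,K}(t_2),\dots,\Delta Z_{n,K}(t_s)\right)\right]\underset{n\to\infty}{\longrightarrow}\int_{\mathbb{R}}\mathbb{E}\left[\varphi\left(x,2W_{t_2},\dots,2W_{t_s}\right)\right]dx,\] where $(W_t)_{t\geq 0}$ is a standard Brownian motion starting from $0$.
   Context: For $K\ge 1$, $V_K=\{-1,+1\}^K$ is the vertex set of the $K$-dimensional hypercube, in which two vertices are adjacent iff they differ in exactly one coordinate. $(Y_K(i))_{i\ge 0}$ is the simple random walk on this graph (at each step a uniformly chosen coordinate, independent of the past, changes sign), started from the law $\mu_K$ on $V_K$. $f_K(v)=\sum_{i=1}^K v^{(i)}$ for $v\in V_K$, and for $t\ge0$: $X_{n,K}(t)=f_K(Y_K(\lfloor nt\rfloor))$, $Z_{n,K}(t)=n^{-1/2}X_{n,K}(t)$, $\Delta Z_{n,K}(t)=Z_{n,K}(t)-Z_{n,K}(0)$. *)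

theory Defs
  imports "HOL-Probability.Probability"
begin

definition hypercube :: "nat \<Rightarrow> (nat \<Rightarrow> real) set" where
  "hypercube K = {1..K} \<rightarrow>\<^sub>E {-1, 1}"

definition hypercube_adj :: "nat \<Rightarrow> (nat \<Rightarrow> real) \<Rightarrow> (nat \<Rightarrow> real) \<Rightarrow> bool" where
  "hypercube_adj K v w \<longleftrightarrow>
     v \<in> hypercube K \<and> w \<in> hypercube K \<and> (\<exists>!c. c \<in> {1..K} \<and> v c \<noteq> w c)"

definition flip :: "nat \<Rightarrow> (nat \<Rightarrow> real) \<Rightarrow> (nat \<Rightarrow> real)" where
  "flip c v = v(c := - v c)"

lemma hypercube_adj_iff_flip:
  assumes "v \<in> hypercube K"
  shows "hypercube_adj K v w \<longleftrightarrow> (\<exists>c\<in>{1..K}. w = flip c v)"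
proof
  assume adj: "hypercube_adj K v w"
  then obtain c where c: "c \<in> {1..K}" "v c \<noteq> w c"
    and uniq: "\<And>d. d \<in> {1..K} \<Longrightarrow> v d \<noteq> w d \<Longrightarrow> d = c"
    unfolding hypercube_adj_def by blast
  have w: "w \<in> {1..K} \<rightarrow>\<^sub>E {-1, 1}" and v: "v \<in> {1..K} \<rightarrow>\<^sub>E {-1, 1}"
    using adj by (simp_all only: hypercube_adj_def hypercube_def)
  have "w c = - v c"
    using PiE_mem[OF w c(1)] PiE_mem[OF v c(1)] c(2) by fastforce
  moreover have "w d = v d" if "d \<noteq> c" for d
    using uniq[of d] PiE_arb[OF v, of d] PiE_arb[OF w, of d] that by metis
  ultimately have "w = flip c v" by (auto simp: flip_def)
  then show "\<exists>c\<in>{1..K}. w = flip c v" using c(1) by blast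
next
  assume "\<exists>c\<in>{1..K}. w = flip c v"
  then obtain c where c: "c \<in> {1..K}" and w: "w = flip c v" by blast
  have v: "v \<in> {1..K} \<rightarrow>\<^sub>E {-1, 1}" using assms by (simp only: hypercube_def)
  have vc: "v c = -1 \<or> v c = 1" using PiE_mem[OF v c] by blast
  have "w \<in> {1..K} \<rightarrow>\<^sub>E {-1, 1}"
  proof (rule PiE_I)
    fix d assume "d \<in> {1..K}"
    then show "w d \<in> {-1, 1}" using PiE_mem[OF v, of d] vc
      by (cases "d = c") (auto simp only: w flip_def fun_upd_apply simp_thms if_True if_False
        insert_iff empty_iff minus_minus)
  next
    fix d assume "d \<notin> {1..K}"
    then show "w d = undefined" using PiE_arb[OF v, of d] c by (metis w flip_def fun_upd_apply)
  qed
  moreover have "\<exists>!d. d \<in> {1..K} \<and> v d \<noteq> w d"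
  proof (rule ex1I)
    show "c \<in> {1..K} \<and> v c \<noteq> w c" using c vc by (auto simp: w flip_def)
    show "d = c" if "d \<in> {1..K} \<and> v d \<noteq> w d" for d
      using that by (metis w flip_def fun_upd_apply)
  qed
  ultimately show "hypercube_adj K v w"
    using assms by (simp only: hypercube_adj_def hypercube_def)
qed

text \<open>
  \<open>C i\<close> is the coordinate flipped at step \<open>i\<close>. Independence of the past is stated for the
  generated sigma-algebras because the library's \<open>indep_var\<close> only relates random variables
  with values in the same type.
\<close>

definition hypercube_walk ::
  "'a measure \<Rightarrow> nat \<Rightarrow> (nat \<Rightarrow> real) measure \<Rightarrow> (nat \<Rightarrow> 'a \<Rightarrow> (nat \<Rightarrow> real)) \<Rightarrow> bool" where
  "hypercube_walk M K \<mu> Y \<longleftrightarrow>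
     prob_space M \<and>
     (\<forall>i. Y i \<in> M \<rightarrow>\<^sub>M count_space (hypercube K)) \<and>
     distr M (count_space (hypercube K)) (Y 0) = \<mu> \<and>
     (\<exists>C. \<forall>i.
        C i \<in> M \<rightarrow>\<^sub>M count_space {1..K} \<and>
        distr M (count_space {1..K}) (C i) = uniform_count_measure {1..K} \<and>
        prob_space.indep_set M
          (sets (vimage_algebra (space M) (C i) (count_space {1..K})))
          (sets (vimage_algebra (space M) (\<lambda>\<omega>. \<lambda>j\<in>{..i}. Y j \<omega>)
             (Pi\<^sub>M {..i} (\<lambda>_. count_space (hypercube K))))) \<and>
        (\<forall>\<omega>\<in>space M. Y (Suc i) \<omega> = flip (C i \<omega>) (Y i \<omega>)))"

definition coord_sum :: "nat \<Rightarrow> (nat \<Rightarrow> real) \<Rightarrow> real" where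
  "coord_sum K v = (\<Sum>i=1..K. v i)"

definition walk_X :: "(nat \<Rightarrow> nat \<Rightarrow> 'a \<Rightarrow> (nat \<Rightarrow> real)) \<Rightarrow> nat \<Rightarrow> nat \<Rightarrow> real \<Rightarrow> 'a \<Rightarrow> real" where
  "walk_X Y n K t \<omega> = coord_sum K (Y K (nat \<lfloor>real n * t\<rfloor>) \<omega>)"

definition walk_Z :: "(nat \<Rightarrow> nat \<Rightarrow> 'a \<Rightarrow> (nat \<Rightarrow> real)) \<Rightarrow> nat \<Rightarrow> nat \<Rightarrow> real \<Rightarrow> 'a \<Rightarrow> real" where
  "walk_Z Y n K t \<omega> = walk_X Y n K t \<omega> / sqrt (real n)"

definition walk_dZ :: "(nat \<Rightarrow> nat \<Rightarrow> 'a \<Rightarrow> (nat \<Rightarrow> real)) \<Rightarrow> nat \<Rightarrow> nat \<Rightarrow> real \<Rightarrow> 'a \<Rightarrow> real" where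
  "walk_dZ Y n K t \<omega> = walk_Z Y n K t \<omega> - walk_Z Y n K 0 \<omega>"

definition standard_brownian_motion :: "'b measure \<Rightarrow> (real \<Rightarrow> 'b \<Rightarrow> real) \<Rightarrow> bool" where
  "standard_brownian_motion N W \<longleftrightarrow>
     prob_space N \<and>
     (\<forall>t\<ge>0. W t \<in> borel_measurable N) \<and>
     (AE \<omega> in N. W 0 \<omega> = 0) \<and>
     (\<forall>r t. 0 \<le> r \<and> r < t \<longrightarrow>
        distributed N lborel (\<lambda>\<omega>. W t \<omega> - W r \<omega>) (normal_density 0 (sqrt (t - r)))) \<and>
     (\<forall>m (u :: nat \<Rightarrow> real). 0 \<le> u 0 \<and> strict_mono_on {..m} u \<longrightarrow>
        prob_space.indep_vars N (\<lambda>_. borel) (\<lambda>j \<omega>. W (u (Suc j)) \<omega> - W (u j) \<omega>) {..<m}) \<and>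
     (AE \<omega> in N. continuous_on {0..} (\<lambda>t. W t \<omega>))"

primrec C_k :: "nat \<Rightarrow> ('a::euclidean_space \<Rightarrow> real) \<Rightarrow> bool" where
  "C_k 0 f \<longleftrightarrow> continuous_on UNIV f"
| "C_k (Suc k) f \<longleftrightarrow>
     (\<forall>x. f differentiable at x) \<and> (\<forall>v. C_k k (\<lambda>x. frechet_derivative f (at x) v))"

definition smooth_compact_support :: "('a::euclidean_space \<Rightarrow> real) \<Rightarrow> bool" where
  "smooth_compact_support f \<longleftrightarrow> (\<forall>k. C_k k f) \<and> compact (closure {x. f x \<noteq> 0})"

end

theory Submission
  imports Defs
begin

text \<open>
  Write \<open>X\<^sub>i\<close> for the coordinate sum after \<open>i\<close> steps. The argument of \<open>\<phi>\<close> is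
  \<open>n\<^sup>-\<^sup>1\<^sup>/\<^sup>2 (X\<^sub>0 b + \<Sum>\<^sub>j (X\<^sub>j\<^sub>+\<^sub>1 - X\<^sub>j) e\<^sub>j)\<close> with deterministic vectors \<open>e\<^sub>j\<close> having entries 0 and 1.
  Given the past, \<open>X\<^sub>j\<^sub>+\<^sub>1 - X\<^sub>j\<close> is \<open>\<plusminus>2\<close> with mean \<open>-2 X\<^sub>j / K\<close>. On the event \<open>X\<^sub>0 = k\<close> with
  \<open>k = O(\<surd>n)\<close> one has \<open>X\<^sub>j = O(\<surd>n)\<close> in mean, so a Lindeberg exchange replaces the
  steps one by one by the Brownian increments \<open>2 (W((j+1)/n) - W(j/n))\<close> at total cost
  \<open>O(n/K + n\<^sup>-\<^sup>1\<^sup>/\<^sup>2)\<close>. By Wallis' product the event has probability about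
  \<open>2 / \<surd>(2 \<pi> K)\<close>, so the sum over all levels \<open>k\<close>, which are spaced by 2, is a Riemann sum with mesh
  \<open>2 / \<surd>n\<close>. It converges by dominated convergence, because returning from \<open>X\<^sub>0 = k\<close> to
  the support of \<open>\<phi>\<close> has probability \<open>O(1 / (1 + k\<^sup>2/n))\<close>. Translation invariance of Lebesgue
  measure turns \<open>x + 2 W(t\<^sub>1)\<close> into \<open>x\<close>.
\<close>

subsection \<open>Local limit theorem for binomial coefficients\<close>

text \<open>The prefactor of order sqrt(K/n) diverges, so convergence in law of the walk does not
  suffice: an error that is merely small would be amplified. Every estimate is therefore confined to
  one starting level by the factor \<open>of_bool (X 0 \<omega> = k)\<close> and is proportional to
  \<open>level_prob k\<close>; no conditional law is ever formed.

  Budget on one level: the drift 2|X_j|/K is of order sqrt(n)/K, is rescaled by 1/sqrt(n) and acts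
  on O(n) steps, which gives O(n/K). Matching mean-zero laws up to second moments costs the cube of
  the step size, n^(-3/2), per step, hence 1/sqrt(n) in total. Only E|X_j| enters, so a second
  moment around the mean k(1-2/K)^j is enough; by a Chebyshev-type argument the same moment bounds
  the return from a remote level.

  Lebesgue measure appears because the relevant levels are O(sqrt n) = o(sqrt K), a scale on which
  the binomial weights are flat. The summation runs over the starting level whereas the first
  coordinate of the limit is the position at the first time, so the limit comes out as an integral
  of phi at x + 2W and has to be translated afterwards.\<close>

lemma central_binomial_wallis:
  "((real ((2*m) choose m) / 4 ^ m)\<^sup>2 * (2 * real m + 1))
     * (\<Prod>k=1..m. (4*real k^2) / (4*real k^2 - 1)) = 1"
proof (induction m)
  case (Suc m)
  have "Suc m * ((2 * Suc m) choose Suc m) = (2 * Suc m) * ((2*m+1) choose m)"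
    using Suc_times_binomial[of m "2*m+1"] by simp
  moreover have "Suc m * ((2*m+1) choose m) = (2*m+1) * ((2*m) choose m)"
    using binomial_absorb_comp[of "2*m+1" m] by simp
  ultimately have r: "real (Suc m) * real ((2 * Suc m) choose Suc m) = 2 * real (Suc m) * real ((2*m+1) choose m)"
      "real (Suc m) * real ((2*m+1) choose m) = (2 * real m + 1) * real ((2*m) choose m)"
    by (simp_all only: flip: of_nat_mult) (simp_all add: algebra_simps)
  have "real (Suc m) * real ((2 * Suc m) choose Suc m) = 2 * ((2*real m+1) * real ((2*m) choose m))"
    unfolding r(1) mult.assoc r(2) ..
  then have b: "real ((2 * Suc m) choose Suc m) = 2 * ((2*real m+1) * real ((2*m) choose m)) / (real m + 1)"
    by (simp add: field_simps)
  define c P where "c = real ((2*m) choose m) / 4 ^ m"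
    and "P = (\<Prod>k=1..m. (4*real k^2) / (4*real k^2 - 1))"
  have IH: "c\<^sup>2 * (2 * real m + 1) * P = 1" using Suc.IH by (simp add: c_def P_def)
  have c: "real ((2 * Suc m) choose Suc m) / 4 ^ Suc m = c * (2*real m+1) / (2 * (real m + 1))"
    unfolding b c_def by (simp add: divide_simps)
  have P: "(\<Prod>k=1..Suc m. (4*real k^2) / (4*real k^2 - 1))
      = P * ((2 * (real m + 1))\<^sup>2 / ((2 * real m + 1) * (2 * real m + 3)))"
    by (simp add: P_def power2_eq_square algebra_simps)
  have s: "2 * real (Suc m) + 1 = 2 * real m + 3" by simp
  have "(c * a / b)\<^sup>2 * d * (P * (b\<^sup>2 / (a * d))) = c\<^sup>2 * a * P"
    if "a > 0" "b > 0" "d > 0" for a b d :: real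
    using that by (simp add: field_simps power2_eq_square)
  from this[of "2 * real m + 1" "2 * (real m + 1)" "2 * real m + 3"]
  show ?case unfolding c P s IH by simp
qed simp

lemma central_binomial_asymp:
  "(\<lambda>m. sqrt (2 * real m + 1) * (real ((2*m) choose m) / 4 ^ m)) \<longlonglongrightarrow> sqrt (2 / pi)"
proof -
  let ?P = "\<lambda>m. \<Prod>k=1..m. (4*real k^2) / (4*real k^2 - 1)"
  have "(\<lambda>m. sqrt (inverse (?P m))) \<longlonglongrightarrow> sqrt (inverse (pi / 2))"
    using tendsto_real_sqrt[OF tendsto_inverse[OF wallis]] by simp
  moreover have "sqrt (inverse (?P m)) = sqrt (2 * real m + 1) * (real ((2*m) choose m) / 4 ^ m)" for m
  proof -
    have "inverse (?P m) = (real ((2*m) choose m) / 4 ^ m)\<^sup>2 * (2 * real m + 1)"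
      by (rule inverse_unique) (subst mult.commute, rule central_binomial_wallis)
    then show ?thesis by (simp add: real_sqrt_mult mult.commute)
  qed
  ultimately show ?thesis by simp
qed

text \<open>Both parities reduce to the central coefficient with index ceil(K/2): for K = 2m+1,
  doubling C(2m+1,m) gives C(2m+2,m+1), and the powers of two match. The remaining factor sqrt(K/(2
  ceil(K/2) + 1)) tends to 1.\<close>

lemma binomial_half_asymp:
  "(\<lambda>K. sqrt (2 * pi * real K) / 2 * (real (K choose (K div 2)) / 2 ^ K)) \<longlonglongrightarrow> 1"
proof -
  let ?c = "\<lambda>m. sqrt (2 * real m + 1) * (real ((2*m) choose m) / 4 ^ m)"
  let ?f = "\<lambda>K. sqrt (2 * pi * real K) / 2 * (real (K choose (K div 2)) / 2 ^ K)"
  define h where "h = (\<lambda>K::nat. (K + 1) div 2)"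
  have eq: "?f K = sqrt (pi / 2) * sqrt (real K / (2 * real (h K) + 1)) * ?c (h K)" for K
  proof -
    have p: "real (K choose (K div 2)) / 2 ^ K = real ((2 * h K) choose (h K)) / 4 ^ (h K)"
    proof (cases "even K")
      case True
      then show ?thesis by (auto simp: h_def power_mult elim!: evenE)
    next
      case False
      then obtain m where m: "K = 2*m+1" by (auto elim: oddE)
      have "Suc m * ((2 * Suc m) choose Suc m) = Suc m * (2 * ((2*m+1) choose m))"
        using Suc_times_binomial[of m "2*m+1"] by simp
      then have "((2 * Suc m) choose Suc m) = 2 * ((2*m+1) choose m)"
        by (metis mult_cancel1 nat.simps(3))
      then show ?thesis by (simp add: m h_def power_mult)
    qed
    have "sqrt (pi / 2) * sqrt (real K / (2 * real (h K) + 1)) * sqrt (2 * real (h K) + 1)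
        = sqrt (pi / 2 * real K)"
      by (simp add: real_sqrt_mult real_sqrt_divide add_nonneg_eq_0_iff)
    also have "pi / 2 * real K = (2 * pi * real K) / 2\<^sup>2" by simp
    also have "sqrt \<dots> = sqrt (2 * pi * real K) / 2"
      by (subst real_sqrt_divide) simp
    finally show ?thesis unfolding p by (metis mult.assoc)
  qed
  have h: "filterlim h at_top sequentially"
    unfolding filterlim_at_top h_def eventually_sequentially
  proof
    fix Z :: nat
    show "\<exists>N. \<forall>n\<ge>N. Z \<le> (n + 1) div 2" by (rule exI[of _ "2 * Z"]) auto
  qed
  have "(\<lambda>K. real K / (2 * real (h K) + 1)) \<longlonglongrightarrow> 1"
  proof (rule tendsto_sandwich)
    show "\<forall>\<^sub>F K in sequentially. 1 - 2 / real K \<le> real K / (2 * real (h K) + 1)"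
    proof (rule eventually_sequentiallyI[of 2])
      fix K :: nat assume K: "2 \<le> K"
      have "2 * real (h K) + 1 \<le> real K + 2" unfolding h_def by linarith
      then have "real K / (real K + 2) \<le> real K / (2 * real (h K) + 1)"
        by (intro divide_left_mono) auto
      moreover have "1 - 2 / real K \<le> real K / (real K + 2)"
        using K by (simp add: field_simps)
      ultimately show "1 - 2 / real K \<le> real K / (2 * real (h K) + 1)" by simp
    qed
    have "real K \<le> 2 * real (h K) + 1" for K unfolding h_def by linarith
    then show "\<forall>\<^sub>F K in sequentially. real K / (2 * real (h K) + 1) \<le> 1"
      by (simp add: divide_le_eq_1)
    have "(\<lambda>K. 1 - 2 * inverse (real K)) \<longlonglongrightarrow> 1 - 2 * 0"
      by (intro tendsto_intros lim_inverse_n)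
    then show "(\<lambda>K. 1 - 2 / real K) \<longlonglongrightarrow> 1" by (simp add: divide_inverse)
  qed simp
  then have "(\<lambda>K. sqrt (pi / 2) * sqrt (real K / (2 * real (h K) + 1)) * ?c (h K))
      \<longlonglongrightarrow> sqrt (pi / 2) * sqrt 1 * sqrt (2 / pi)"
    by (intro tendsto_intros filterlim_compose[OF central_binomial_asymp h])
  moreover have "sqrt (pi / 2) * sqrt 1 * sqrt (2 / pi) = 1"
    by (simp flip: real_sqrt_mult)
  ultimately show ?thesis unfolding eq by simp
qed

text \<open>With x = 2j - K, the ratio of consecutive coefficients is 1 - (x+1)/(j+1), at least 1 -
  2(x+1)/K to the right of the middle. The product of these factors is bounded below by the
  quadratic 1 - x^2/K, which avoids exponentials and is sharp enough for x = o(sqrt K).\<close>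

lemma binomial_ge_half:
  assumes "K div 2 \<le> j" "j \<le> K" "K \<ge> 1"
  shows "(1 - (2 * real j - real K)\<^sup>2 / real K) * real (K choose (K div 2)) \<le> real (K choose j)"
  using assms(1,2)
proof (induction j rule: dec_induct)
  case base
  show ?case by (simp add: mult_left_le_one_le algebra_simps)
next
  case (step j)
  let ?a = "real (K choose (K div 2))"
  define x where "x = 2 * real j - real K"
  have x: "x \<ge> -1" using step.hyps unfolding x_def by linarith
  have rec: "real (j + 1) * real (K choose Suc j) = real (K - j) * real (K choose j)"
    using binomial_absorb_comp[of K j] binomial_absorption[of j K]
    by (metis Suc_eq_plus1 of_nat_mult)
  have Kj: "real (K - j) = real K - real j" using step.prems by simp
  have e: "real (K choose Suc j) = (real K - real j) / (real j + 1) * real (K choose j)"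
    using rec unfolding Kj by (simp add: field_simps)
  have xK: "2 * real (Suc j) - real K = x + 2" by (simp add: x_def)
  show ?case
  \<comment> \<open>The ratio bound may be multiplied onto the induction hypothesis only while the
    quadratic factor is nonnegative. Once it is negative, the factor for \<open>x + 2\<close> is
    negative as well and the claim is trivial.\<close>
  proof (cases "1 - x\<^sup>2 / real K \<ge> 0")
    case True
    have "1 - 2 * (x + 1) / real K \<le> 1 - (x + 1) / (real j + 1)"
    proof -
      have "K \<le> 2 * (j + 1)" using step.hyps(1) by presburger
      from of_nat_mono[where 'a=real, OF this] have "real K \<le> 2 * (real j + 1)" by simp
      then have "(x + 1) * real K \<le> (x + 1) * (2 * (real j + 1))"
        using x by (intro mult_left_mono) auto
      then show ?thesis using assms(3) by (simp add: field_simps)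
    qed
    also have "1 - (x + 1) / (real j + 1) = (real K - real j) / (real j + 1)"
      by (simp add: x_def field_simps)
    finally have r: "1 - 2 * (x + 1) / real K \<le> (real K - real j) / (real j + 1)" .
    have "1 - (x + 2)\<^sup>2 / real K \<le> (1 - 2 * (x + 1) / real K) * (1 - x\<^sup>2 / real K)"
    proof -
      have "(1 - 2 * (x + 1) / real K) * (1 - x\<^sup>2 / real K)
          = 1 - (2 * (x + 1) + x\<^sup>2) / real K + (2 * (x + 1) / real K) * (x\<^sup>2 / real K)"
        by (simp add: algebra_simps diff_divide_distrib add_divide_distrib)
      also have "\<dots> \<ge> 1 - (2 * (x + 1) + x\<^sup>2) / real K"
        using x by simp
      \<comment> \<open>The slack is 2x + 2, nonnegative because \<open>x \<ge> -1\<close>; this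
        value is attained at the middle of an odd \<open>K\<close>.\<close>
      also have "(2 * (x + 1) + x\<^sup>2) / real K \<le> (x + 2)\<^sup>2 / real K"
        using x by (intro divide_right_mono) (auto simp: power2_eq_square algebra_simps)
      ultimately show ?thesis by linarith
    qed
    also have "\<dots> \<le> (real K - real j) / (real j + 1) * (1 - x\<^sup>2 / real K)"
      by (intro mult_right_mono r True)
    finally have "(1 - (x + 2)\<^sup>2 / real K) * ?a
        \<le> (real K - real j) / (real j + 1) * ((1 - x\<^sup>2 / real K) * ?a)"
      by (metis mult.assoc mult_right_mono of_nat_0_le_iff)
    also have "\<dots> \<le> (real K - real j) / (real j + 1) * real (K choose j)"
      using step by (intro mult_left_mono) (auto simp: x_def)
    finally show ?thesis unfolding e xK .
  next
    case False
    have "1 - (x + 2)\<^sup>2 / real K \<le> 1 - x\<^sup>2 / real K"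
      using x by (intro diff_left_mono divide_right_mono) (auto simp: power2_eq_square algebra_simps)
    with False have "(1 - (x + 2)\<^sup>2 / real K) * ?a \<le> 0"
      by (intro mult_nonpos_nonneg) auto
    then show ?thesis unfolding xK by (rule order_trans) simp
  qed
qed

lemma binomial_ge:
  assumes "j \<le> K" "K \<ge> 1"
  shows "(1 - (2 * real j - real K)\<^sup>2 / real K) * real (K choose (K div 2)) \<le> real (K choose j)"
proof (cases "K div 2 \<le> j")
  case True
  then show ?thesis using binomial_ge_half assms by blast
next
  case False
  then have "K div 2 \<le> K - j" by linarith
  from binomial_ge_half[OF this] assms
  have "(1 - (2 * real (K - j) - real K)\<^sup>2 / real K) * real (K choose (K div 2)) \<le> real (K choose j)"
    using binomial_symmetric[of j K] by simp
  moreover have "(2 * real (K - j) - real K)\<^sup>2 = (2 * real j - real K)\<^sup>2"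
    using assms by (simp add: power2_eq_square algebra_simps)
  ultimately show ?thesis by simp
qed

text \<open>Squeezed between the quadratic lower bound of \<open>binomial_ge\<close> and the maximal
  coefficient in the middle. Since the distance to the centre is o(sqrt K), the Gaussian factor of
  the general local limit theorem is 1 here.\<close>

lemma binomial_local_limit:
  assumes K: "filterlim K at_top sequentially"
    and j: "\<forall>\<^sub>F n in sequentially. j n \<le> K n"
    and d: "(\<lambda>n. (2 * real (j n) - real (K n))\<^sup>2 / real (K n)) \<longlonglongrightarrow> 0"
  shows "(\<lambda>n. sqrt (2 * pi * real (K n)) / 2 * (real (K n choose j n) / 2 ^ K n)) \<longlonglongrightarrow> 1"
proof -
  let ?f = "\<lambda>K. sqrt (2 * pi * real K) / 2 * (real (K choose (K div 2)) / 2 ^ K)"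
  have f: "(\<lambda>n. ?f (K n)) \<longlonglongrightarrow> 1"
    by (rule filterlim_compose[OF binomial_half_asymp K])
  have "(\<lambda>n. (1 - (2 * real (j n) - real (K n))\<^sup>2 / real (K n)) * ?f (K n)) \<longlonglongrightarrow> (1 - 0) * 1"
    by (intro tendsto_intros d f)
  then have lo: "(\<lambda>n. (1 - (2 * real (j n) - real (K n))\<^sup>2 / real (K n)) * ?f (K n)) \<longlonglongrightarrow> 1"
    by simp
  have hi: "\<forall>\<^sub>F n in sequentially. sqrt (2 * pi * real (K n)) / 2 * (real (K n choose j n) / 2 ^ K n) \<le> ?f (K n)"
    by (intro always_eventually allI mult_left_mono divide_right_mono) (auto simp: binomial_maximum)
  have "\<forall>\<^sub>F n in sequentially. K n \<ge> 1" using K by (simp add: filterlim_at_top)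
  with j have "\<forall>\<^sub>F n in sequentially. (1 - (2 * real (j n) - real (K n))\<^sup>2 / real (K n)) * ?f (K n)
      \<le> sqrt (2 * pi * real (K n)) / 2 * (real (K n choose j n) / 2 ^ K n)"
  proof eventually_elim
    case (elim n)
    define A where "A = 1 - (2 * real (j n) - real (K n))\<^sup>2 / real (K n)"
    have "sqrt (2 * pi * real (K n)) / 2 * ((A * real (K n choose (K n div 2))) / 2 ^ K n)
        \<le> sqrt (2 * pi * real (K n)) / 2 * (real (K n choose j n) / 2 ^ K n)"
      unfolding A_def by (intro mult_left_mono divide_right_mono binomial_ge elim) auto
    then show ?case unfolding A_def[symmetric] by (simp add: mult_ac)
  qed
  from tendsto_sandwich[OF this hi lo f] show ?thesis .
qed

text \<open>A convergent sequence is bounded and the middle coefficient is maximal, so one constant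
  serves all levels and all dimensions. It enters the dominating function of the Riemann
  sums.\<close>

lemma binomial_local_bound:
  obtains c where "c > 0"
    "\<And>K j. sqrt (2 * pi * real K) / 2 * (real (K choose j) / 2 ^ K) \<le> c"
proof -
  let ?f = "\<lambda>K. sqrt (2 * pi * real K) / 2 * (real (K choose (K div 2)) / 2 ^ K)"
  have "Bseq ?f" using binomial_half_asymp convergent_imp_Bseq convergentI by blast
  then obtain c where c: "c > 0" "\<And>K. norm (?f K) \<le> c" by (auto elim!: BseqE)
  show thesis
  proof (rule that[OF c(1)])
    fix K j
    have "sqrt (2 * pi * real K) / 2 * (real (K choose j) / 2 ^ K) \<le> ?f K"
      by (intro mult_left_mono divide_right_mono) (auto simp: binomial_maximum)
    also have "\<dots> \<le> c" using c(2)[of K] by simp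
    finally show "sqrt (2 * pi * real K) / 2 * (real (K choose j) / 2 ^ K) \<le> c" .
  qed
qed

subsection \<open>Functions with cubic Taylor remainder along a direction\<close>

primrec dir_deriv :: "'a::euclidean_space \<Rightarrow> nat \<Rightarrow> ('a \<Rightarrow> real) \<Rightarrow> 'a \<Rightarrow> real" where
  "dir_deriv e 0 f = f"
| "dir_deriv e (Suc m) f = (\<lambda>x. frechet_derivative (dir_deriv e m f) (at x) e)"

lemma C_k_dir_deriv: "(\<And>k. C_k k f) \<Longrightarrow> C_k k (dir_deriv e m f)"
proof (induction m arbitrary: k)
  case (Suc m)
  from Suc.IH[OF Suc.prems, of "Suc k"] show ?case by simp
qed simp

lemma dir_deriv_has_derivative:
  assumes "\<And>k. C_k k f"
  shows "((\<lambda>s. dir_deriv e m f (a + s *\<^sub>R e)) has_real_derivative dir_deriv e (Suc m) f (a + s *\<^sub>R e)) (at s)"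
proof -
  let ?g = "dir_deriv e m f"
  have "?g differentiable at (a + s *\<^sub>R e)"
    using C_k_dir_deriv[OF assms, of "Suc 0" e m] by simp
  then have D: "(?g has_derivative frechet_derivative ?g (at (a + s *\<^sub>R e))) (at (a + s *\<^sub>R e))"
    by (simp add: frechet_derivative_works)
  have "((\<lambda>s. a + s *\<^sub>R e) has_derivative (\<lambda>h. h *\<^sub>R e)) (at s)"
    by (auto intro!: derivative_eq_intros)
  from has_derivative_compose[OF this D]
  have "((\<lambda>s. ?g (a + s *\<^sub>R e)) has_derivative
      (\<lambda>h. frechet_derivative ?g (at (a + s *\<^sub>R e)) (h *\<^sub>R e))) (at s)" .
  moreover have "frechet_derivative ?g (at (a + s *\<^sub>R e)) (h *\<^sub>R e)
      = frechet_derivative ?g (at (a + s *\<^sub>R e)) e * h" for h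
    using linear_cmul[OF has_derivative_linear[OF D]] by simp
  ultimately show ?thesis by (simp add: has_field_derivative_def)
qed

lemma dir_deriv_eq_0:
  assumes "\<And>k. C_k k f" "x \<notin> closure {x. f x \<noteq> 0}"
  shows "dir_deriv e m f x = 0"
  using assms(2)
proof (induction m arbitrary: x)
  case 0
  then show ?case using closure_subset by force
next
  case (Suc m)
  let ?g = "dir_deriv e m f" and ?S = "- closure {x. f x \<noteq> 0}"
  have "((\<lambda>_. 0) has_derivative (\<lambda>_. 0)) (at x)" by simp
  then have "(?g has_derivative (\<lambda>_. 0)) (at x)"
    by (rule has_derivative_transform_within_open[where s = ?S]) (use Suc in auto)
  then have "frechet_derivative ?g (at x) = (\<lambda>_. 0)"
    by (metis frechet_derivative_at)
  then show ?case by simp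
qed

lemma dir_deriv_bounded:
  assumes "smooth_compact_support f"
  obtains B where "B \<ge> 0" "\<And>x. \<bar>dir_deriv e m f x\<bar> \<le> B"
proof -
  let ?g = "dir_deriv e m f" and ?S = "closure {x. f x \<noteq> 0}"
  have C: "C_k k f" for k using assms by (simp add: smooth_compact_support_def)
  have cont: "continuous_on UNIV ?g" using C_k_dir_deriv[OF C, where k = 0] by simp
  have "compact (?g ` ?S)"
    using assms cont by (intro compact_continuous_image)
      (auto simp: smooth_compact_support_def intro: continuous_on_subset)
  then obtain B where B: "\<And>x. x \<in> ?S \<Longrightarrow> \<bar>?g x\<bar> \<le> B"
    by (fastforce dest!: compact_imp_bounded simp: bounded_iff)
  show thesis
  \<comment> \<open>The support may be empty, in which case nothing prevents \<open>B\<close> from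
    being negative.\<close>
  proof (rule that[of "max B 0"])
    fix x show "\<bar>?g x\<bar> \<le> max B 0"
      using B[of x] dir_deriv_eq_0[OF C, of x e m] by (cases "x \<in> ?S") auto
  qed simp
qed

text \<open>The second symmetric difference of \<open>g\<close> along \<open>e\<close> is quadratic up to a cubic error.
  Stated without derivatives, the condition passes to averages of translates of \<open>g\<close>.\<close>

definition lindeberg_regular :: "real \<Rightarrow> 'a::euclidean_space \<Rightarrow> ('a \<Rightarrow> real) \<Rightarrow> bool" where
  "lindeberg_regular L e g \<longleftrightarrow>
     (\<forall>a r. \<bar>g (a + r *\<^sub>R e) - g a\<bar> \<le> L * \<bar>r\<bar>) \<and>
     (\<forall>a r s. \<bar>g (a + (r * s) *\<^sub>R e) + g (a - (r * s) *\<^sub>R e) - 2 * g a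
        - s\<^sup>2 * (g (a + r *\<^sub>R e) + g (a - r *\<^sub>R e) - 2 * g a)\<bar> \<le> L * \<bar>r\<bar> ^ 3 * (\<bar>s\<bar> ^ 3 + s\<^sup>2))"

lemma lindeberg_regular_lipschitz:
  "lindeberg_regular L e g \<Longrightarrow> \<bar>g (a + r *\<^sub>R e) - g a\<bar> \<le> L * \<bar>r\<bar>"
  by (simp add: lindeberg_regular_def)

lemma lindeberg_regular_cubic:
  "lindeberg_regular L e g \<Longrightarrow> \<bar>g (a + (r * s) *\<^sub>R e) + g (a - (r * s) *\<^sub>R e) - 2 * g a
     - s\<^sup>2 * (g (a + r *\<^sub>R e) + g (a - r *\<^sub>R e) - 2 * g a)\<bar> \<le> L * \<bar>r\<bar> ^ 3 * (\<bar>s\<bar> ^ 3 + s\<^sup>2)"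
  unfolding lindeberg_regular_def by blast

lemma lindeberg_regular_mono:
  assumes "lindeberg_regular L e g" "L \<le> L'"
  shows "lindeberg_regular L' e g"
  unfolding lindeberg_regular_def
proof (intro conjI allI)
  fix a r s
  show "\<bar>g (a + r *\<^sub>R e) - g a\<bar> \<le> L' * \<bar>r\<bar>"
    using assms mult_right_mono[OF assms(2), of "\<bar>r\<bar>"]
    by (auto simp: lindeberg_regular_def intro: order_trans)
  have "L * \<bar>r\<bar> ^ 3 * (\<bar>s\<bar> ^ 3 + s\<^sup>2) \<le> L' * \<bar>r\<bar> ^ 3 * (\<bar>s\<bar> ^ 3 + s\<^sup>2)"
    using assms(2) by (intro mult_right_mono) auto
  then show "\<bar>g (a + (r * s) *\<^sub>R e) + g (a - (r * s) *\<^sub>R e) - 2 * g a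
        - s\<^sup>2 * (g (a + r *\<^sub>R e) + g (a - r *\<^sub>R e) - 2 * g a)\<bar> \<le> L' * \<bar>r\<bar> ^ 3 * (\<bar>s\<bar> ^ 3 + s\<^sup>2)"
    using assms(1) unfolding lindeberg_regular_def by (meson order_trans)
qed

text \<open>Taylor expansion with third-order remainder along the line through \<open>a\<close>. The
  first-order terms cancel in a symmetric difference, and subtracting \<open>s\<^sup>2\<close> times
  the difference at scale \<open>r\<close> removes the second derivative, so only third derivatives
  remain.\<close>

lemma smooth_compact_support_lindeberg_regular:
  assumes "smooth_compact_support f"
  obtains L where "L \<ge> 0" "lindeberg_regular L e f"
proof -
  have C: "C_k k f" for k using assms by (simp add: smooth_compact_support_def)
  obtain B1 where B1: "B1 \<ge> 0" "\<And>x. \<bar>dir_deriv e 1 f x\<bar> \<le> B1"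
    using dir_deriv_bounded[OF assms, of e 1] by blast
  obtain B3 where B3: "B3 \<ge> 0" "\<And>x. \<bar>dir_deriv e 3 f x\<bar> \<le> B3"
    using dir_deriv_bounded[OF assms, of e 3] by blast
  define L where "L = max B1 B3"
  have tay: "\<exists>t. f (a + s *\<^sub>R e) = (\<Sum>m<n. (dir_deriv e m f a / fact m) * s ^ m)
      + (dir_deriv e n f (a + t *\<^sub>R e) / fact n) * s ^ n" for a s n
  proof -
    have "\<forall>m x. DERIV (\<lambda>s. dir_deriv e m f (a + s *\<^sub>R e)) x :> dir_deriv e (Suc m) f (a + x *\<^sub>R e)"
      using dir_deriv_has_derivative[OF C] by blast
    from Maclaurin_all_le[where diff = "\<lambda>m s. dir_deriv e m f (a + s *\<^sub>R e)" and x = s and n = n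
      and f = "\<lambda>s. f (a + s *\<^sub>R e)", OF _ this]
    show ?thesis by auto
  qed
  have "lindeberg_regular L e f"
    unfolding lindeberg_regular_def
  proof (intro conjI allI)
    fix a r
    obtain t where "f (a + r *\<^sub>R e) = f a + dir_deriv e 1 f (a + t *\<^sub>R e) * r"
      using tay[of a r 1] by auto
    then have "\<bar>f (a + r *\<^sub>R e) - f a\<bar> = \<bar>dir_deriv e 1 f (a + t *\<^sub>R e)\<bar> * \<bar>r\<bar>"
      by (simp add: abs_mult)
    also have "\<dots> \<le> L * \<bar>r\<bar>"
      using B1(2)[of "a + t *\<^sub>R e"] by (intro mult_right_mono) (auto simp: L_def)
    finally show "\<bar>f (a + r *\<^sub>R e) - f a\<bar> \<le> L * \<bar>r\<bar>" .
  next
    fix a r s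
    define q where "q = dir_deriv e 2 f a"
    define d where "d = dir_deriv e 1 f a"
    \<comment> \<open>\<open>d\<close> and \<open>q\<close> are the first two derivatives at
      \<open>a\<close>. The expansion is applied at u = rs, -rs, r and -r.\<close>
    have half: "\<bar>f (a + u *\<^sub>R e) - f a - d * u - q / 2 * u\<^sup>2\<bar> \<le> L / 6 * \<bar>u\<bar> ^ 3" for u
    proof -
      obtain t where "f (a + u *\<^sub>R e) = f a + d * u + q / 2 * u\<^sup>2
          + (dir_deriv e 3 f (a + t *\<^sub>R e) / 6) * u ^ 3"
        using tay[of a u 3] by (auto simp: d_def q_def eval_nat_numeral)
      then have "\<bar>f (a + u *\<^sub>R e) - f a - d * u - q / 2 * u\<^sup>2\<bar>
          = \<bar>dir_deriv e 3 f (a + t *\<^sub>R e)\<bar> / 6 * \<bar>u\<bar> ^ 3"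
        by (simp add: abs_mult power_abs)
      also have "\<dots> \<le> L / 6 * \<bar>u\<bar> ^ 3"
        using B3(2)[of "a + t *\<^sub>R e"] by (intro mult_right_mono) (auto simp: L_def)
      finally show ?thesis .
    qed
    have sym: "\<bar>f (a + u *\<^sub>R e) + f (a - u *\<^sub>R e) - 2 * f a - q * u\<^sup>2\<bar> \<le> L / 3 * \<bar>u\<bar> ^ 3" for u
    proof -
      have "\<bar>f (a - u *\<^sub>R e) - f a + d * u - q / 2 * u\<^sup>2\<bar> \<le> L / 6 * \<bar>u\<bar> ^ 3"
        using half[of "- u"] by simp
      with half[of u] show ?thesis by linarith
    qed
    define A where "A = f (a + (r * s) *\<^sub>R e) + f (a - (r * s) *\<^sub>R e) - 2 * f a"
    define R where "R = f (a + r *\<^sub>R e) + f (a - r *\<^sub>R e) - 2 * f a"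
    have A: "\<bar>A - q * (r * s)\<^sup>2\<bar> \<le> L / 3 * (\<bar>r\<bar> ^ 3 * \<bar>s\<bar> ^ 3)"
      using sym[of "r * s"] by (simp add: A_def abs_mult power_mult_distrib)
    have "\<bar>R - q * r\<^sup>2\<bar> * s\<^sup>2 \<le> L / 3 * \<bar>r\<bar> ^ 3 * s\<^sup>2"
      using sym[of r] by (intro mult_right_mono) (auto simp: R_def)
    then have R: "\<bar>s\<^sup>2 * R - q * (r * s)\<^sup>2\<bar> \<le> L / 3 * \<bar>r\<bar> ^ 3 * s\<^sup>2"
    proof -
      have "\<bar>R - q * r\<^sup>2\<bar> * s\<^sup>2 = \<bar>(R - q * r\<^sup>2) * s\<^sup>2\<bar>" by (simp add: abs_mult)
      also have "(R - q * r\<^sup>2) * s\<^sup>2 = s\<^sup>2 * R - q * (r * s)\<^sup>2"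
        by (simp add: algebra_simps power_mult_distrib)
      finally show ?thesis using \<open>\<bar>R - q * r\<^sup>2\<bar> * s\<^sup>2 \<le> _\<close> by simp
    qed
    have "\<bar>A - s\<^sup>2 * R\<bar> \<le> L / 3 * (\<bar>r\<bar> ^ 3 * \<bar>s\<bar> ^ 3) + L / 3 * \<bar>r\<bar> ^ 3 * s\<^sup>2"
      using A R by linarith
    also have "\<dots> = (L * \<bar>r\<bar> ^ 3 * (\<bar>s\<bar> ^ 3 + s\<^sup>2)) / 3"
      by (simp add: algebra_simps)
    also have "\<dots> \<le> L * \<bar>r\<bar> ^ 3 * (\<bar>s\<bar> ^ 3 + s\<^sup>2)"
    proof -
      have "0 \<le> L * \<bar>r\<bar> ^ 3 * (\<bar>s\<bar> ^ 3 + s\<^sup>2)" using B1(1) by (auto simp: L_def)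
      then show ?thesis by simp
    qed
    finally show "\<bar>f (a + (r * s) *\<^sub>R e) + f (a - (r * s) *\<^sub>R e) - 2 * f a
        - s\<^sup>2 * (f (a + r *\<^sub>R e) + f (a - r *\<^sub>R e) - 2 * f a)\<bar> \<le> L * \<bar>r\<bar> ^ 3 * (\<bar>s\<bar> ^ 3 + s\<^sup>2)"
      by (simp add: A_def R_def)
  qed
  then show thesis using that[of L] B1(1) by (auto simp: L_def)
qed

text \<open>The differences in \<open>lindeberg_regular\<close> are linear in \<open>g\<close> and
  the bounds are uniform in the base point, so they survive integration with the same
  \<open>L\<close>. In the exchange argument \<open>S\<close> is the Gaussian sum over the steps not
  yet replaced, and no differentiation under the integral is required.\<close>

lemma (in prob_space) lindeberg_regular_average:
  fixes g :: "'b::euclidean_space \<Rightarrow> real"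
  assumes g: "lindeberg_regular L e g" "g \<in> borel_measurable borel" "\<And>x. \<bar>g x\<bar> \<le> B"
    and S: "S \<in> borel_measurable M"
  shows "lindeberg_regular L e (\<lambda>a. expectation (\<lambda>\<omega>. g (a + S \<omega>)))"
proof -
  have i: "integrable M (\<lambda>\<omega>. g (a + S \<omega>))" for a
    using g S by (intro integrable_const_bound[of _ B]) auto
  have abs_le: "\<bar>expectation F\<bar> \<le> c" if "integrable M F" "\<And>\<omega>. \<bar>F \<omega>\<bar> \<le> c"
    for F :: "'a \<Rightarrow> real" and c
  proof -
    have "\<bar>expectation F\<bar> \<le> expectation (\<lambda>\<omega>. \<bar>F \<omega>\<bar>)" using integral_norm_bound[of M F] by simp
    also have "\<dots> \<le> expectation (\<lambda>\<omega>. c)" using that by (intro integral_mono) auto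
    finally show ?thesis by (simp add: prob_space)
  qed
  show ?thesis
    unfolding lindeberg_regular_def
  proof (intro conjI allI)
    fix a r
    have "\<bar>expectation (\<lambda>\<omega>. g (a + r *\<^sub>R e + S \<omega>) - g (a + S \<omega>))\<bar> \<le> L * \<bar>r\<bar>"
    proof (rule abs_le)
      fix \<omega>
      show "\<bar>g (a + r *\<^sub>R e + S \<omega>) - g (a + S \<omega>)\<bar> \<le> L * \<bar>r\<bar>"
        using lindeberg_regular_lipschitz[OF g(1), of "a + S \<omega>" r] by (simp add: add_ac)
    qed (auto simp: i)
    then show "\<bar>expectation (\<lambda>\<omega>. g (a + r *\<^sub>R e + S \<omega>)) - expectation (\<lambda>\<omega>. g (a + S \<omega>))\<bar> \<le> L * \<bar>r\<bar>"
      by (simp add: i)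
  next
    fix a r s
    have "\<bar>expectation (\<lambda>\<omega>. g (a + (r * s) *\<^sub>R e + S \<omega>) + g (a - (r * s) *\<^sub>R e + S \<omega>) - 2 * g (a + S \<omega>)
        - s\<^sup>2 * (g (a + r *\<^sub>R e + S \<omega>) + g (a - r *\<^sub>R e + S \<omega>) - 2 * g (a + S \<omega>)))\<bar>
      \<le> L * \<bar>r\<bar> ^ 3 * (\<bar>s\<bar> ^ 3 + s\<^sup>2)"
    proof (rule abs_le)
      fix \<omega>
      have "\<bar>g (a + S \<omega> + (r * s) *\<^sub>R e) + g (a + S \<omega> - (r * s) *\<^sub>R e) - 2 * g (a + S \<omega>)
        - s\<^sup>2 * (g (a + S \<omega> + r *\<^sub>R e) + g (a + S \<omega> - r *\<^sub>R e) - 2 * g (a + S \<omega>))\<bar>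
        \<le> L * \<bar>r\<bar> ^ 3 * (\<bar>s\<bar> ^ 3 + s\<^sup>2)"
        by (rule lindeberg_regular_cubic[OF g(1)])
      then show "\<bar>g (a + (r * s) *\<^sub>R e + S \<omega>) + g (a - (r * s) *\<^sub>R e + S \<omega>) - 2 * g (a + S \<omega>)
        - s\<^sup>2 * (g (a + r *\<^sub>R e + S \<omega>) + g (a - r *\<^sub>R e + S \<omega>) - 2 * g (a + S \<omega>))\<bar>
        \<le> L * \<bar>r\<bar> ^ 3 * (\<bar>s\<bar> ^ 3 + s\<^sup>2)"
        by (simp only: diff_conv_add_uminus add_ac)
    qed (auto simp: i)
    then show "\<bar>expectation (\<lambda>\<omega>. g (a + (r * s) *\<^sub>R e + S \<omega>)) + expectation (\<lambda>\<omega>. g (a - (r * s) *\<^sub>R e + S \<omega>))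
        - 2 * expectation (\<lambda>\<omega>. g (a + S \<omega>))
        - s\<^sup>2 * (expectation (\<lambda>\<omega>. g (a + r *\<^sub>R e + S \<omega>)) + expectation (\<lambda>\<omega>. g (a - r *\<^sub>R e + S \<omega>))
           - 2 * expectation (\<lambda>\<omega>. g (a + S \<omega>)))\<bar> \<le> L * \<bar>r\<bar> ^ 3 * (\<bar>s\<bar> ^ 3 + s\<^sup>2)"
      by (simp add: i)
  qed
qed

text \<open>The Gaussian and the symmetric two-point law with the same variance agree up to second
  moments, and \<open>\<bar>s\<bar>\<^sup>3 \<le> (s\<^sup>2 + s\<^sup>4) / 2\<close> bounds the third absolute moment by 2.\<close>

lemma (in prob_space) gaussian_two_point_diff:
  fixes h :: "'b::euclidean_space \<Rightarrow> real"
  assumes D: "distributed M lborel D (normal_density 0 \<sigma>)" and \<sigma>: "\<sigma> > 0"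
    and h: "lindeberg_regular L e h" "h \<in> borel_measurable borel" "\<And>x. \<bar>h x\<bar> \<le> B"
    and L: "L \<ge> 0"
  shows "\<bar>expectation (\<lambda>\<omega>. h (a + D \<omega> *\<^sub>R e)) - (h (a + \<sigma> *\<^sub>R e) + h (a - \<sigma> *\<^sub>R e)) / 2\<bar> \<le> 3 / 2 * L * \<sigma> ^ 3"
proof -
  have "distributed M lborel (\<lambda>x. 0 + inverse \<sigma> * D x) (normal_density (0 + inverse \<sigma> * 0) (\<bar>inverse \<sigma>\<bar> * \<sigma>))"
    using \<sigma> by (intro normal_density_affine D) auto
  then have G: "distributed M lborel (\<lambda>x. inverse \<sigma> * D x) std_normal_density"
    using \<sigma> by simp
  define f where "f s = h (a + (\<sigma> * s) *\<^sub>R e)" for s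
  have [measurable]: "f \<in> borel_measurable borel" unfolding f_def using h(2) by measurable
  have fB: "\<bar>f s\<bar> \<le> B" for s using h(3) by (simp add: f_def)
  have E: "expectation (\<lambda>\<omega>. h (a + D \<omega> *\<^sub>R e)) = (\<integral>s. std_normal_density s * f s \<partial>lborel)"
    using distributed_integral[OF G, of f] \<sigma> by (simp add: f_def field_simps)
  have i: "integrable lborel (\<lambda>s. std_normal_density s * g s)"
    if [measurable]: "g \<in> borel_measurable borel" and "\<And>s. \<bar>g s\<bar> \<le> B" for g
    by (rule Bochner_Integration.integrable_bound[of _ "\<lambda>s. std_normal_density s * B"])
      (auto simp: abs_mult intro!: mult_left_mono order_trans[OF that(2)])
  \<comment> \<open>Symmetry of the Gaussian turns twice the expectation into the integral of
    \<open>f s + f (- s)\<close>, to which the symmetric difference bound applies.\<close>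
  have refl: "(\<integral>s. std_normal_density s * f s \<partial>lborel) = (\<integral>s. std_normal_density s * f (- s) \<partial>lborel)"
    using lborel_integral_real_affine[of "-1" "\<lambda>s. std_normal_density s * f s" 0]
    by (simp add: std_normal_density_def)
  \<comment> \<open>\<open>c\<close> is the second difference at the two-point law and
    \<open>w\<close> the remainder of the comparison. Because the normal law has second moment 1,
    the integral of \<open>w\<close> is exactly twice the difference to be estimated.\<close>
  define c where "c = f 1 + f (- 1) - 2 * f 0"
  define w where "w s = f s + f (- s) - 2 * f 0 - s\<^sup>2 * c" for s
  have w: "\<bar>w s\<bar> \<le> L * \<sigma> ^ 3 * (\<bar>s\<bar> ^ 3 + s\<^sup>2)" for s
    using lindeberg_regular_cubic[OF h(1), of a \<sigma> s] \<sigma> by (simp add: w_def f_def c_def)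
  have m2: "has_bochner_integral lborel (\<lambda>s. std_normal_density s * s\<^sup>2) 1"
    using std_normal_moment_even[of 1] by simp
  have m4: "has_bochner_integral lborel (\<lambda>s. std_normal_density s * s ^ 4) 3"
    using std_normal_moment_even[of 2] by (simp add: fact_numeral)
  have m0: "has_bochner_integral lborel (\<lambda>s. std_normal_density s) 1"
    using std_normal_moment_even[of 0] by simp
  have I: "has_bochner_integral lborel (\<lambda>s. std_normal_density s * w s)
     (2 * (\<integral>s. std_normal_density s * f s \<partial>lborel) - 2 * f 0 - c)"
  proof -
    have "has_bochner_integral lborel (\<lambda>s. std_normal_density s * f s + std_normal_density s * f (- s)
        - std_normal_density s * (2 * f 0) - (std_normal_density s * s\<^sup>2) * c)
      ((\<integral>s. std_normal_density s * f s \<partial>lborel) + (\<integral>s. std_normal_density s * f (- s) \<partial>lborel) - 1 * (2 * f 0) - 1 * c)"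
      by (intro has_bochner_integral_diff has_bochner_integral_add has_bochner_integral_integrable i
          has_bochner_integral_mult_left m0 m2) (auto simp: fB)
    then show ?thesis unfolding refl[symmetric] by (simp add: w_def algebra_simps)
  qed
  \<comment> \<open>The majorant integrates to 3/2 + 1/2 * 3 = 3 by the second and fourth normal
    moments; halving at the end gives the constant 3/2.\<close>
  have J: "has_bochner_integral lborel
      (\<lambda>s. L * \<sigma> ^ 3 * (3 / 2 * (std_normal_density s * s\<^sup>2) + 1 / 2 * (std_normal_density s * s ^ 4)))
      (L * \<sigma> ^ 3 * (3 / 2 * 1 + 1 / 2 * 3))"
    by (intro has_bochner_integral_mult_right has_bochner_integral_add m2 m4)
  have "\<bar>2 * (\<integral>s. std_normal_density s * f s \<partial>lborel) - 2 * f 0 - c\<bar>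
      = \<bar>\<integral>s. std_normal_density s * w s \<partial>lborel\<bar>"
    using has_bochner_integral_integral_eq[OF I] by simp
  also have "\<dots> \<le> (\<integral>s. \<bar>std_normal_density s * w s\<bar> \<partial>lborel)"
    using integral_norm_bound[of lborel "\<lambda>s. std_normal_density s * w s"] by simp
  also have "\<dots> \<le> (\<integral>s. L * \<sigma> ^ 3 * (3 / 2 * (std_normal_density s * s\<^sup>2) + 1 / 2 * (std_normal_density s * s ^ 4)) \<partial>lborel)"
  proof (rule integral_mono)
    show "integrable lborel (\<lambda>s. \<bar>std_normal_density s * w s\<bar>)"
      using I by (auto intro: integrable.intros)
    show "integrable lborel (\<lambda>s. L * \<sigma> ^ 3 * (3 / 2 * (std_normal_density s * s\<^sup>2) + 1 / 2 * (std_normal_density s * s ^ 4)))"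
      using J by (rule integrable.intros)
    fix s :: real
    have "0 \<le> s\<^sup>2 * (\<bar>s\<bar> - 1)\<^sup>2" by simp
    also have "\<dots> = s ^ 4 + s\<^sup>2 - 2 * \<bar>s\<bar> ^ 3"
      by (simp add: power2_eq_square power3_eq_cube power4_eq_xxxx algebra_simps abs_if)
    finally have s3: "\<bar>s\<bar> ^ 3 + s\<^sup>2 \<le> 3 / 2 * s\<^sup>2 + 1 / 2 * s ^ 4" by simp
    have "\<bar>w s\<bar> \<le> L * \<sigma> ^ 3 * (3 / 2 * s\<^sup>2 + 1 / 2 * s ^ 4)"
      using L \<sigma> by (intro order_trans[OF w] mult_left_mono s3) auto
    then have "std_normal_density s * \<bar>w s\<bar> \<le> std_normal_density s * (L * \<sigma> ^ 3 * (3 / 2 * s\<^sup>2 + 1 / 2 * s ^ 4))"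
      by (intro mult_left_mono) auto
    then show "\<bar>std_normal_density s * w s\<bar>
        \<le> L * \<sigma> ^ 3 * (3 / 2 * (std_normal_density s * s\<^sup>2) + 1 / 2 * (std_normal_density s * s ^ 4))"
      by (simp add: abs_mult algebra_simps)
  qed
  also have "\<dots> = 3 * L * \<sigma> ^ 3"
    using has_bochner_integral_integral_eq[OF J] by simp
  finally have "\<bar>2 * (expectation (\<lambda>\<omega>. h (a + D \<omega> *\<^sub>R e))
      - (h (a + \<sigma> *\<^sub>R e) + h (a - \<sigma> *\<^sub>R e)) / 2)\<bar> \<le> 3 * L * \<sigma> ^ 3"
    unfolding E by (simp add: c_def f_def field_simps)
  then show ?thesis unfolding abs_mult by simp
qed

text \<open>Fubini for the independent blocks \<open>{i}\<close> and \<open>{Suc i..<m}\<close>. It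
  exhibits the average over all Gaussians from \<open>i\<close> on as the average, over
  \<open>D i\<close> alone, of the next averaged function, which is the recursion behind the
  exchange of a single step.\<close>

lemma (in prob_space) indep_sum_split:
  fixes g :: "'b::euclidean_space \<Rightarrow> real" and D :: "nat \<Rightarrow> 'a \<Rightarrow> real"
  assumes ind: "indep_vars (\<lambda>_. borel) D {..<m}" and i: "i < m"
    and g: "g \<in> borel_measurable borel" "\<And>x. \<bar>g x\<bar> \<le> B"
  shows "expectation (\<lambda>\<omega>. g (a + (\<Sum>j=i..<m. D j \<omega> *\<^sub>R u j)))
    = expectation (\<lambda>\<omega>. expectation (\<lambda>\<omega>'. g (a + D i \<omega> *\<^sub>R u i + (\<Sum>j=Suc i..<m. D j \<omega>' *\<^sub>R u j))))"
proof -
  let ?S = "PiM {i} (\<lambda>_. borel :: real measure)" and ?T = "PiM {Suc i..<m} (\<lambda>_. borel :: real measure)"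
  let ?X = "\<lambda>\<omega>. \<lambda>j\<in>{i}. D j \<omega>" and ?Y = "\<lambda>\<omega>. \<lambda>j\<in>{Suc i..<m}. D j \<omega>"
  define F where "F = (\<lambda>p. g (a + fst p i *\<^sub>R u i + (\<Sum>j=Suc i..<m. snd p j *\<^sub>R u j)))"
  have iv: "indep_var ?S ?X ?T ?Y"
    using i by (intro indep_var_restrict[OF ind]) auto
  then have X[measurable]: "?X \<in> M \<rightarrow>\<^sub>M ?S" and Y[measurable]: "?Y \<in> M \<rightarrow>\<^sub>M ?T"
    and eq: "distr M ?S ?X \<Otimes>\<^sub>M distr M ?T ?Y = distr M (?S \<Otimes>\<^sub>M ?T) (\<lambda>x. (?X x, ?Y x))"
    by (auto simp: indep_var_distribution_eq)
  have F[measurable]: "F \<in> borel_measurable (?S \<Otimes>\<^sub>M ?T)"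
    unfolding F_def using g(1) by measurable
  interpret P1: prob_space "distr M ?S ?X" by (rule prob_space_distr[OF X])
  interpret P2: prob_space "distr M ?T ?Y" by (rule prob_space_distr[OF Y])
  interpret P: pair_prob_space "distr M ?S ?X" "distr M ?T ?Y" ..
  have iF: "integrable (distr M ?S ?X \<Otimes>\<^sub>M distr M ?T ?Y) F"
    by (rule P.integrable_const_bound[of _ B])
      (simp add: F_def g(2), use F in \<open>simp cong: measurable_cong_sets\<close>)
  have "expectation (\<lambda>\<omega>. g (a + (\<Sum>j=i..<m. D j \<omega> *\<^sub>R u j))) = expectation (\<lambda>\<omega>. F (?X \<omega>, ?Y \<omega>))"
    using i by (simp add: F_def sum.atLeast_Suc_lessThan add.assoc)
  also have "\<dots> = (\<integral>p. F p \<partial>distr M (?S \<Otimes>\<^sub>M ?T) (\<lambda>x. (?X x, ?Y x)))"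
    by (subst integral_distr) auto
  also have "\<dots> = (\<integral>x. (\<integral>y. F (x, y) \<partial>distr M ?T ?Y) \<partial>distr M ?S ?X)"
    unfolding eq[symmetric] by (rule P.integral_fst'[symmetric, OF iF])
  also have "\<dots> = (\<integral>x. (\<integral>\<omega>'. F (x, ?Y \<omega>') \<partial>M) \<partial>distr M ?S ?X)"
    by (intro Bochner_Integration.integral_cong refl integral_distr) auto
  also have "\<dots> = (\<integral>\<omega>. (\<integral>\<omega>'. F (?X \<omega>, ?Y \<omega>') \<partial>M) \<partial>M)"
    by (intro integral_distr) auto
  finally show ?thesis by (simp add: F_def)
qed

subsection \<open>The walk on the hypercube\<close>

lemma finite_hypercube [simp]: "finite (hypercube K)"
  by (simp add: hypercube_def finite_PiE)

lemma hypercube_cases: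
  assumes "v \<in> hypercube K" "c \<in> {1..K}"
  obtains "v c = 1" | "v c = - 1"
  using assms PiE_mem[of v "{1..K}" "\<lambda>_. {-1, 1}" c] by (auto simp: hypercube_def)

lemma coord_sum_flip:
  assumes "c \<in> {1..K}"
  shows "coord_sum K (flip c v) = coord_sum K v - 2 * v c"
proof -
  have "coord_sum K (flip c v) = - v c + (\<Sum>i\<in>{1..K} - {c}. v i)"
    unfolding coord_sum_def flip_def using assms by (subst sum.remove[of _ c]) auto
  moreover have "coord_sum K v = v c + (\<Sum>i\<in>{1..K} - {c}. v i)"
    unfolding coord_sum_def using assms by (subst sum.remove[of _ c]) auto
  ultimately show ?thesis by simp
qed

text \<open>On the two points 1 and -1 every function is affine, so its average over the coordinates
  involves \<open>v\<close> only through the coordinate sum. The slope term is the drift of the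
  walk.\<close>

lemma hypercube_coordinate_average:
  assumes "v \<in> hypercube K" "K \<ge> 1"
  shows "(\<Sum>c=1..K. f (v c)) / real K
    = (f 1 + f (- 1)) / 2 + coord_sum K v / real K * ((f 1 - f (- 1)) / 2 :: real)"
proof -
  have "(\<Sum>c=1..K. f (v c)) = (\<Sum>c=1..K. (f 1 + f (- 1)) / 2 + v c * ((f 1 - f (- 1)) / 2))"
  proof (rule sum.cong)
    fix c assume "c \<in> {1..K}"
    then show "f (v c) = (f 1 + f (- 1)) / 2 + v c * ((f 1 - f (- 1)) / 2)"
      by (cases rule: hypercube_cases[OF assms(1)]) (auto simp: field_simps)
  qed simp
  also have "\<dots> = real K * ((f 1 + f (- 1)) / 2) + coord_sum K v * ((f 1 - f (- 1)) / 2)"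
    by (simp add: sum.distrib sum_distrib_right coord_sum_def)
  finally show ?thesis using assms(2) by (simp add: field_simps)
qed

lemma card_hypercube: "card (hypercube K) = 2 ^ K"
  by (simp add: hypercube_def card_PiE numeral_2_eq_2)

lemma card_hypercube_level:
  "card {v \<in> hypercube K. coord_sum K v = 2 * real j - real K} = K choose j"
proof -
  let ?V = "{v \<in> hypercube K. coord_sum K v = 2 * real j - real K}"
  let ?S = "{S. S \<subseteq> {1..K} \<and> card S = j}"
  \<comment> \<open>A vertex corresponds to the set of its coordinates equal to 1. The restricted
    abstraction keeps the inverse map extensional, as \<open>hypercube\<close> demands.\<close>
  let ?f = "\<lambda>S. \<lambda>c\<in>{1..K}. if c \<in> S then 1 else - 1 :: real"
  let ?g = "\<lambda>v. {c \<in> {1..K}. v c = (1::real)}"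
  have sum_f: "coord_sum K (?f S) = 2 * real (card S) - real K" if "S \<subseteq> {1..K}" for S
  proof -
    have "coord_sum K (?f S) = (\<Sum>c=1..K. 2 * of_bool (c \<in> S) - 1)"
      unfolding coord_sum_def by (intro sum.cong) auto
    also have "\<dots> = 2 * (\<Sum>c=1..K. of_bool (c \<in> S)) - real K"
      by (simp add: sum_subtractf sum_distrib_left)
    also have "(\<Sum>c=1..K. of_bool (c \<in> S)) = real (card ({1..K} \<inter> S))"
      by (simp add: Int_def)
    also have "{1..K} \<inter> S = S" using that by auto
    finally show ?thesis .
  qed
  have fg: "?f (?g v) = v" if "v \<in> hypercube K" for v
  proof
    fix c
    show "?f (?g v) c = v c"
    proof (cases "c \<in> {1..K}")
      case True
      then show ?thesis by (cases rule: hypercube_cases[OF that]) auto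
    next
      case False
      then show ?thesis using that by (auto simp: hypercube_def)
    qed
  qed
  have "bij_betw ?g ?V ?S"
  proof (rule bij_betwI[where g = ?f])
    show "?g \<in> ?V \<rightarrow> ?S"
    proof
      fix v assume v: "v \<in> ?V"
      then have "coord_sum K (?f (?g v)) = 2 * real j - real K"
        by (subst fg) auto
      moreover have "coord_sum K (?f (?g v)) = 2 * real (card (?g v)) - real K"
        by (rule sum_f) auto
      ultimately show "?g v \<in> ?S" by auto
    qed
    show "?f \<in> ?S \<rightarrow> ?V"
      using sum_f by (auto simp: hypercube_def)
    show "?f (?g v) = v" if "v \<in> ?V" for v using that fg by auto
    show "?g (?f S) = S" if "S \<in> ?S" for S using that by (auto split: if_splits)
  qed
  then have "card ?V = card ?S" by (rule bij_betw_same_card)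
  also have "\<dots> = K choose j" using n_subsets[of "{1..K}" j] by simp
  finally show ?thesis .
qed

text \<open>One walk in a fixed dimension. \<open>C\<close> is a witness of the existential
  quantifier in \<open>hypercube_walk\<close>, made a parameter so that the flipped coordinate can
  be named.\<close>

locale uniform_hypercube_walk = prob_space M for M :: "'a measure" +
  fixes K :: nat and Y :: "nat \<Rightarrow> 'a \<Rightarrow> nat \<Rightarrow> real" and C :: "nat \<Rightarrow> 'a \<Rightarrow> nat"
  assumes K_ge_1: "K \<ge> 1"
    and Y_measurable: "Y i \<in> M \<rightarrow>\<^sub>M count_space (hypercube K)"
    and Y_start: "distr M (count_space (hypercube K)) (Y 0) = uniform_count_measure (hypercube K)"
    and C_measurable: "C i \<in> M \<rightarrow>\<^sub>M count_space {1..K}"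
    and C_uniform: "distr M (count_space {1..K}) (C i) = uniform_count_measure {1..K}"
    and C_indep: "indep_set (sets (vimage_algebra (space M) (C i) (count_space {1..K})))
          (sets (vimage_algebra (space M) (\<lambda>\<omega>. \<lambda>j\<in>{..i}. Y j \<omega>)
             (Pi\<^sub>M {..i} (\<lambda>_. count_space (hypercube K)))))"
    and Y_step: "\<omega> \<in> space M \<Longrightarrow> Y (Suc i) \<omega> = flip (C i \<omega>) (Y i \<omega>)"
begin

section \<open>The finite path space and one-step expectations\<close>

definition path :: "nat \<Rightarrow> 'a \<Rightarrow> nat \<Rightarrow> nat \<Rightarrow> real" where
  "path i \<omega> = (\<lambda>j\<in>{..i}. Y j \<omega>)"

definition Paths :: "nat \<Rightarrow> (nat \<Rightarrow> nat \<Rightarrow> real) set" where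
  "Paths i = ({..i} \<rightarrow>\<^sub>E hypercube K)"

text \<open>Measurability with respect to the past, in pointwise form. As there are finitely many
  paths, no sigma-algebra on the target is needed, so the notion also covers function-valued maps
  such as the integrand in \<open>expectation_step\<close>.\<close>

definition adapted :: "nat \<Rightarrow> ('a \<Rightarrow> 'b) \<Rightarrow> bool" where
  "adapted i f \<longleftrightarrow> (\<forall>\<omega>\<in>space M. \<forall>\<omega>'\<in>space M. (\<forall>j\<le>i. Y j \<omega> = Y j \<omega>') \<longrightarrow> f \<omega> = f \<omega>')"

definition X :: "nat \<Rightarrow> 'a \<Rightarrow> real" where
  "X i \<omega> = coord_sum K (Y i \<omega>)"

lemma Y_in: "\<omega> \<in> space M \<Longrightarrow> Y i \<omega> \<in> hypercube K"
  using measurable_space[OF Y_measurable] by simp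

lemma C_in: "\<omega> \<in> space M \<Longrightarrow> C i \<omega> \<in> {1..K}"
  using measurable_space[OF C_measurable] by (metis space_count_space)

lemma X_Suc: "\<omega> \<in> space M \<Longrightarrow> X (Suc i) \<omega> = X i \<omega> - 2 * Y i \<omega> (C i \<omega>)"
  by (simp add: X_def Y_step coord_sum_flip[OF C_in])

lemma finite_Paths [simp]: "finite (Paths i)"
  by (simp add: Paths_def finite_PiE)

lemma path_in: "\<omega> \<in> space M \<Longrightarrow> path i \<omega> \<in> Paths i"
  by (auto simp: path_def Paths_def Y_in)

lemma PiM_Paths: "Pi\<^sub>M {..i} (\<lambda>_. count_space (hypercube K)) = count_space (Paths i)"
  unfolding Paths_def by (rule count_space_PiM_finite) (auto intro: countable_finite)

lemma path_measurable: "path i \<in> M \<rightarrow>\<^sub>M count_space (Paths i)"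
  unfolding PiM_Paths[symmetric] path_def[abs_def]
  by (rule measurable_restrict) (rule Y_measurable)

lemma adapted_path:
  assumes "adapted i f"
  obtains F where "\<And>\<omega>. \<omega> \<in> space M \<Longrightarrow> f \<omega> = F (path i \<omega>)"
proof
  fix \<omega> assume \<omega>: "\<omega> \<in> space M"
  \<comment> \<open>The chosen representative depends on \<open>\<omega>\<close> only through its
    path, so evaluating \<open>f\<close> there is a function of the path.\<close>
  let ?\<omega>' = "SOME \<omega>'. \<omega>' \<in> space M \<and> path i \<omega>' = path i \<omega>"
  have \<omega>': "?\<omega>' \<in> space M" "path i ?\<omega>' = path i \<omega>"
    using someI[of "\<lambda>\<omega>'. \<omega>' \<in> space M \<and> path i \<omega>' = path i \<omega>" \<omega>] \<omega> by auto
  have "Y j \<omega> = Y j ?\<omega>'" if "j \<le> i" for j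
    using fun_cong[OF \<omega>'(2), of j] that by (simp add: path_def)
  then show "f \<omega> = f ?\<omega>'" using assms \<omega> \<omega>'(1) unfolding adapted_def by blast
qed

text \<open>Factoring through the finite set \<open>Paths i\<close> makes the function bounded and
  measurable. Integrability of polynomials in the walk follows without any moment estimate.\<close>

lemma adapted_integrable:
  fixes f :: "'a \<Rightarrow> real"
  assumes "adapted i f"
  shows "integrable M f"
proof -
  obtain F where F: "\<And>\<omega>. \<omega> \<in> space M \<Longrightarrow> f \<omega> = F (path i \<omega>)" using adapted_path[OF assms] by blast
  have "(\<lambda>\<omega>. F (path i \<omega>)) \<in> borel_measurable M"
    by (rule measurable_compose[OF path_measurable]) simp
  moreover have "norm (F (path i \<omega>)) \<le> (\<Sum>p\<in>Paths i. norm (F p))" if "\<omega> \<in> space M" for \<omega>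
    using path_in[OF that] by (intro member_le_sum) auto
  ultimately have "integrable M (\<lambda>\<omega>. F (path i \<omega>))"
    by (intro integrable_const_bound[of _ "\<Sum>p\<in>Paths i. norm (F p)"]) auto
  then show ?thesis by (simp cong: Bochner_Integration.integrable_cong add: F)
qed

lemma prob_coordinate_path:
  assumes "p \<in> Paths i" "c \<in> {1..K}"
  shows "prob ((C i -` {c} \<inter> space M) \<inter> (path i -` {p} \<inter> space M)) = prob (path i -` {p} \<inter> space M) / real K"
proof -
  have "prob (C i -` {c} \<inter> space M) = measure (distr M (count_space {1..K}) (C i)) {c}"
    using assms(2) by (subst measure_distr[OF C_measurable]) auto
  also have "\<dots> = 1 / real K"
    unfolding C_uniform using assms(2) by (subst measure_uniform_count_measure) auto
  finally have c: "prob (C i -` {c} \<inter> space M) = 1 / real K" .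
  have "prob ((C i -` {c} \<inter> space M) \<inter> (path i -` {p} \<inter> space M))
      = prob (C i -` {c} \<inter> space M) * prob (path i -` {p} \<inter> space M)"
  proof (rule indep_setD[OF C_indep])
    show "C i -` {c} \<inter> space M \<in> sets (vimage_algebra (space M) (C i) (count_space {1..K}))"
      using assms(2) by (intro in_vimage_algebra) auto
    show "path i -` {p} \<inter> space M \<in> sets (vimage_algebra (space M) (\<lambda>\<omega>. \<lambda>j\<in>{..i}. Y j \<omega>)
             (Pi\<^sub>M {..i} (\<lambda>_. count_space (hypercube K))))"
      unfolding PiM_Paths path_def[abs_def] using assms(1) by (intro in_vimage_algebra) auto
  qed
  then show ?thesis unfolding c by simp
qed

text \<open>Independence and uniformity give each atom, a path together with a coordinate, the
  probability of the path divided by \<open>K\<close>. Summation over these atoms replaces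
  conditional expectation given the past.\<close>

lemma expectation_path_coordinate:
  fixes F :: "(nat \<Rightarrow> nat \<Rightarrow> real) \<Rightarrow> nat \<Rightarrow> real"
  shows "expectation (\<lambda>\<omega>. F (path i \<omega>) (C i \<omega>)) = expectation (\<lambda>\<omega>. (\<Sum>c=1..K. F (path i \<omega>) c) / real K)"
proof -
  define A where "A p = path i -` {p} \<inter> space M" for p
  define B where "B c = C i -` {c} \<inter> space M" for c
  have [measurable]: "A p \<in> events" if "p \<in> Paths i" for p
    unfolding A_def using that by (intro measurable_sets[OF path_measurable]) auto
  have [measurable]: "B c \<in> events" if "c \<in> {1..K}" for c
    unfolding B_def using that by (intro measurable_sets[OF C_measurable]) auto
  have "F (path i \<omega>) (C i \<omega>) = (\<Sum>p\<in>Paths i. \<Sum>c=1..K. F p c * indicator (B c \<inter> A p) \<omega>)"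
    if \<omega>: "\<omega> \<in> space M" for \<omega>
  proof -
    have "(\<Sum>p\<in>Paths i. \<Sum>c=1..K. F p c * indicator (B c \<inter> A p) \<omega>)
        = (\<Sum>p\<in>Paths i. if p = path i \<omega> then (\<Sum>c=1..K. if c = C i \<omega> then F p c else 0) else 0)"
      using \<omega> by (intro sum.cong refl) (auto simp: A_def B_def indicator_def intro!: sum.neutral sum.cong)
    also have "\<dots> = F (path i \<omega>) (C i \<omega>)"
      using path_in[OF \<omega>, of i] C_in[OF \<omega>, of i] by (simp add: sum.delta)
    finally show ?thesis by simp
  qed
  then have "expectation (\<lambda>\<omega>. F (path i \<omega>) (C i \<omega>))
      = expectation (\<lambda>\<omega>. \<Sum>p\<in>Paths i. \<Sum>c=1..K. F p c * indicator (B c \<inter> A p) \<omega>)"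
    by (intro Bochner_Integration.integral_cong) auto
  also have "\<dots> = (\<Sum>p\<in>Paths i. \<Sum>c=1..K. F p c * prob (B c \<inter> A p))"
  proof -
    have i: "integrable M (\<lambda>\<omega>. F p c * indicator (B c \<inter> A p) \<omega>)" if "p \<in> Paths i" "c \<in> {1..K}" for p c
      using that by (intro integrable_mult_right integrable_real_indicator)
        (auto simp: less_top[symmetric])
    have "expectation (\<lambda>\<omega>. \<Sum>p\<in>Paths i. \<Sum>c=1..K. F p c * indicator (B c \<inter> A p) \<omega>)
        = (\<Sum>p\<in>Paths i. expectation (\<lambda>\<omega>. \<Sum>c=1..K. F p c * indicator (B c \<inter> A p) \<omega>))"
      by (intro Bochner_Integration.integral_sum Bochner_Integration.integrable_sum i)
    also have "\<dots> = (\<Sum>p\<in>Paths i. \<Sum>c=1..K. expectation (\<lambda>\<omega>. F p c * indicator (B c \<inter> A p) \<omega>))"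
      by (intro sum.cong refl Bochner_Integration.integral_sum i)
    also have "\<dots> = (\<Sum>p\<in>Paths i. \<Sum>c=1..K. F p c * prob (B c \<inter> A p))"
      by (intro sum.cong refl) (simp add: A_def B_def Int_assoc)
    finally show ?thesis .
  qed
  also have "\<dots> = (\<Sum>p\<in>Paths i. (\<Sum>c=1..K. F p c) / real K * prob (A p))"
    using prob_coordinate_path[of _ i]
    by (intro sum.cong refl) (simp add: A_def B_def sum_distrib_right sum_divide_distrib)
  also have "\<dots> = expectation (\<lambda>\<omega>. \<Sum>p\<in>Paths i. (\<Sum>c=1..K. F p c) / real K * indicator (A p) \<omega>)"
  proof -
    have i: "integrable M (\<lambda>\<omega>. a * indicator (A p) \<omega>)" if "p \<in> Paths i" for p and a :: real
      using that by (intro integrable_mult_right integrable_real_indicator)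
        (auto simp: less_top[symmetric])
    have "expectation (\<lambda>\<omega>. \<Sum>p\<in>Paths i. (\<Sum>c=1..K. F p c) / real K * indicator (A p) \<omega>)
        = (\<Sum>p\<in>Paths i. expectation (\<lambda>\<omega>. (\<Sum>c=1..K. F p c) / real K * indicator (A p) \<omega>))"
      by (intro Bochner_Integration.integral_sum i)
    also have "\<dots> = (\<Sum>p\<in>Paths i. (\<Sum>c=1..K. F p c) / real K * prob (A p))"
      by (intro sum.cong refl) (simp add: A_def)
    finally show ?thesis by simp
  qed
  also have "\<dots> = expectation (\<lambda>\<omega>. (\<Sum>c=1..K. F (path i \<omega>) c) / real K)"
  proof (intro Bochner_Integration.integral_cong refl)
    fix \<omega> assume \<omega>: "\<omega> \<in> space M"
    have "(\<Sum>p\<in>Paths i. (\<Sum>c=1..K. F p c) / real K * indicator (A p) \<omega>)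
        = (\<Sum>p\<in>Paths i. if p = path i \<omega> then (\<Sum>c=1..K. F p c) / real K else 0)"
      using \<omega> by (intro sum.cong refl) (auto simp: A_def)
    then show "(\<Sum>p\<in>Paths i. (\<Sum>c=1..K. F p c) / real K * indicator (A p) \<omega>)
        = (\<Sum>c=1..K. F (path i \<omega>) c) / real K"
      using path_in[OF \<omega>, of i] by (simp add: sum.delta)
  qed
  finally show ?thesis .
qed

text \<open>Given the past, the old value of the flipped coordinate is 1 or -1 with probabilities (1
  + X_i/K)/2 and (1 - X_i/K)/2. By \<open>X_Suc\<close> any function of the next position has the
  form of the integrand, so this is the generator of the walk split into a symmetric part and a
  drift.\<close>

lemma expectation_step:
  fixes G :: "'a \<Rightarrow> real \<Rightarrow> real"
  assumes "adapted i G"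
  shows "expectation (\<lambda>\<omega>. G \<omega> (Y i \<omega> (C i \<omega>)))
    = expectation (\<lambda>\<omega>. (G \<omega> 1 + G \<omega> (- 1)) / 2 + X i \<omega> / real K * ((G \<omega> 1 - G \<omega> (- 1)) / 2))"
proof -
  obtain F where F: "\<And>\<omega>. \<omega> \<in> space M \<Longrightarrow> G \<omega> = F (path i \<omega>)" using adapted_path[OF assms] by blast
  have "expectation (\<lambda>\<omega>. G \<omega> (Y i \<omega> (C i \<omega>))) = expectation (\<lambda>\<omega>. F (path i \<omega>) (path i \<omega> i (C i \<omega>)))"
    by (intro Bochner_Integration.integral_cong) (auto simp: F path_def)
  also have "\<dots> = expectation (\<lambda>\<omega>. (\<Sum>c=1..K. F (path i \<omega>) (path i \<omega> i c)) / real K)"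
    by (rule expectation_path_coordinate[of "\<lambda>p c. F p (p i c)"])
  also have "\<dots> = expectation (\<lambda>\<omega>. (\<Sum>c=1..K. G \<omega> (Y i \<omega> c)) / real K)"
    by (intro Bochner_Integration.integral_cong) (auto simp: F path_def)
  also have "\<dots> = expectation (\<lambda>\<omega>. (G \<omega> 1 + G \<omega> (- 1)) / 2 + X i \<omega> / real K * ((G \<omega> 1 - G \<omega> (- 1)) / 2))"
    unfolding X_def
    by (intro Bochner_Integration.integral_cong refl hypercube_coordinate_average Y_in K_ge_1)
  finally show ?thesis .
qed

lemma adapted_X: "j \<le> i \<Longrightarrow> adapted i (X j)"
  by (simp add: adapted_def X_def)

lemma adapted_compose2: "adapted i f \<Longrightarrow> adapted i g \<Longrightarrow> adapted i (\<lambda>\<omega>. h (f \<omega>) (g \<omega>))"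
  unfolding adapted_def by metis

lemma adapted_sum:
  assumes "\<And>j. j \<in> J \<Longrightarrow> adapted i (f j)"
  shows "adapted i (\<lambda>\<omega>. \<Sum>j\<in>J. f j \<omega>)"
  unfolding adapted_def
proof (intro ballI impI sum.cong refl)
  fix \<omega> \<omega>' j
  assume "\<omega> \<in> space M" "\<omega>' \<in> space M" "\<forall>j\<le>i. Y j \<omega> = Y j \<omega>'" "j \<in> J"
  then show "f j \<omega> = f j \<omega>'" using assms[of j] unfolding adapted_def by blast
qed

section \<open>Starting levels and moments of the walk issued from one level\<close>

definition level_prob :: "real \<Rightarrow> real" where
  "level_prob k = expectation (\<lambda>\<omega>. of_bool (X 0 \<omega> = k))"

lemma level_prob_nonneg: "level_prob k \<ge> 0"
  unfolding level_prob_def by (rule integral_nonneg_AE) simp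

lemma level_prob_eq: "level_prob (2 * real j - real K) = real (K choose j) / 2 ^ K"
proof -
  let ?V = "{v \<in> hypercube K. coord_sum K v = 2 * real j - real K}"
  have "level_prob (2 * real j - real K) = expectation (indicator (Y 0 -` ?V \<inter> space M))"
    unfolding level_prob_def
    by (intro Bochner_Integration.integral_cong) (auto simp: X_def Y_in)
  also have "\<dots> = prob (Y 0 -` ?V \<inter> space M)" by simp
  also have "\<dots> = measure (distr M (count_space (hypercube K)) (Y 0)) ?V"
    by (subst measure_distr[OF Y_measurable]) auto
  also have "\<dots> = real (K choose j) / 2 ^ K"
    unfolding Y_start by (subst measure_uniform_count_measure)
      (auto simp: card_hypercube card_hypercube_level)
  finally show ?thesis .
qed

text \<open>From level \<open>k\<close> the mean after \<open>i\<close> steps is k(1-2/K)^i, because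
  one step multiplies it by 1 - 2/K. Each step adds a variance of at most 4 and otherwise contracts
  the deviation.\<close>

lemma second_moment_from_level:
  "expectation (\<lambda>\<omega>. of_bool (X 0 \<omega> = k) * (X i \<omega> - k * (1 - 2 / real K) ^ i)\<^sup>2)
     \<le> 4 * real i * level_prob k"
proof (induction i)
  case 0
  have "expectation (\<lambda>\<omega>. of_bool (X 0 \<omega> = k) * (X 0 \<omega> - k * (1 - 2 / real K) ^ 0)\<^sup>2) = expectation (\<lambda>\<omega>. 0)"
    by (intro Bochner_Integration.integral_cong) auto
  then show ?case by simp
next
  case (Suc i)
  let ?\<rho> = "1 - 2 / real K"
  define \<kappa> where "\<kappa> = k * ?\<rho> ^ i"
  have \<kappa>': "k * ?\<rho> ^ Suc i = ?\<rho> * \<kappa>" by (simp add: \<kappa>_def)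
  define G where "G \<omega> y = of_bool (X 0 \<omega> = k) * (X i \<omega> - 2 * y - ?\<rho> * \<kappa>)\<^sup>2" for \<omega> y
  have aG: "adapted i G" unfolding G_def[abs_def]
    by (rule adapted_compose2[OF adapted_X[of 0] adapted_X[of i]]) auto
  have i1: "integrable M (\<lambda>\<omega>. (G \<omega> 1 + G \<omega> (- 1)) / 2 + X i \<omega> / real K * ((G \<omega> 1 - G \<omega> (- 1)) / 2))"
    by (rule adapted_integrable[of i]) (rule adapted_compose2[OF adapted_X[of i] aG], simp)
  have i2: "integrable M (\<lambda>\<omega>. of_bool (X 0 \<omega> = k) * (X i \<omega> - \<kappa>)\<^sup>2)"
    by (rule adapted_integrable[of i]) (rule adapted_compose2[OF adapted_X[of 0] adapted_X[of i]]; simp)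
  have i3: "integrable M (\<lambda>\<omega>. of_bool (X 0 \<omega> = k) :: real)"
    by (rule adapted_integrable[of 0]) (rule adapted_compose2[OF adapted_X[of 0] adapted_X[of 0]]; simp)
  have le: "(G \<omega> 1 + G \<omega> (- 1)) / 2 + X i \<omega> / real K * ((G \<omega> 1 - G \<omega> (- 1)) / 2)
      \<le> of_bool (X 0 \<omega> = k) * (X i \<omega> - \<kappa>)\<^sup>2 + 4 * of_bool (X 0 \<omega> = k)" for \<omega>
  proof -
    define u q where "u = X i \<omega> - \<kappa>" and "q = 1 / real K"
    have q: "0 \<le> q" "q \<le> 1" using K_ge_1 by (auto simp: q_def)
    \<comment> \<open>The new second moment is (1-2q)^2 u^2 + 4(1 - (qX)^2) with X = u +
      \<open>\<kappa>\<close>. The first summand on the right is the contraction loss, the second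
      the amount by which the step variance falls short of 4.\<close>
    have "u\<^sup>2 + 4 - (((u + \<kappa> - 2 - (1 - 2 * q) * \<kappa>)\<^sup>2 + (u + \<kappa> + 2 - (1 - 2 * q) * \<kappa>)\<^sup>2) / 2
        + (u + \<kappa>) * q * (((u + \<kappa> - 2 - (1 - 2 * q) * \<kappa>)\<^sup>2 - (u + \<kappa> + 2 - (1 - 2 * q) * \<kappa>)\<^sup>2) / 2))
      = 4 * u\<^sup>2 * (q * (1 - q)) + 4 * (q * (\<kappa> + u))\<^sup>2"
      by (simp add: power2_eq_square field_simps)
    also have "\<dots> \<ge> 0" using q by (intro add_nonneg_nonneg mult_nonneg_nonneg) auto
    finally show ?thesis
      by (cases "X 0 \<omega> = k") (auto simp: G_def u_def q_def)
  qed
  have "expectation (\<lambda>\<omega>. of_bool (X 0 \<omega> = k) * (X (Suc i) \<omega> - k * ?\<rho> ^ Suc i)\<^sup>2)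
      = expectation (\<lambda>\<omega>. G \<omega> (Y i \<omega> (C i \<omega>)))"
    unfolding \<kappa>' by (intro Bochner_Integration.integral_cong) (auto simp: G_def X_Suc)
  also have "\<dots> = expectation (\<lambda>\<omega>. (G \<omega> 1 + G \<omega> (- 1)) / 2 + X i \<omega> / real K * ((G \<omega> 1 - G \<omega> (- 1)) / 2))"
    by (rule expectation_step[OF aG])
  also have "\<dots> \<le> expectation (\<lambda>\<omega>. of_bool (X 0 \<omega> = k) * (X i \<omega> - \<kappa>)\<^sup>2 + 4 * of_bool (X 0 \<omega> = k))"
    by (intro integral_mono i1 Bochner_Integration.integrable_add i2 integrable_mult_right i3 le)
  also have "\<dots> = expectation (\<lambda>\<omega>. of_bool (X 0 \<omega> = k) * (X i \<omega> - \<kappa>)\<^sup>2) + 4 * level_prob k"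
    by (simp add: i2 i3 level_prob_def)
  also have "\<dots> \<le> 4 * real (Suc i) * level_prob k"
    using Suc.IH by (simp add: \<kappa>_def algebra_simps)
  finally show ?case .
qed

end

subsection \<open>Exchange of the steps against Gaussian variables\<close>

context uniform_hypercube_walk
begin

text \<open>The deviation u is bounded by sqrt(n)/2 + u^2/(2 sqrt n). Unlike Cauchy-Schwarz under
  the expectation, this pointwise inequality keeps the result directly proportional to
  \<open>level_prob k\<close>. The summand 2T is half the variance bound 4Tn, divided by sqrt n on
  both counts of scale.\<close>

lemma first_moment_from_level:
  fixes n T :: real
  assumes n: "n > 0" and i: "real i \<le> T * n"
  shows "expectation (\<lambda>\<omega>. of_bool (X 0 \<omega> = k) * \<bar>X i \<omega>\<bar>) \<le> level_prob k * (\<bar>k\<bar> + sqrt n * (1 / 2 + 2 * T))"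
proof -
  define \<kappa> where "\<kappa> = k * (1 - 2 / real K) ^ i"
  have "\<bar>1 - 2 / real K\<bar> \<le> 1"
    using K_ge_1 by (auto simp: abs_le_iff field_simps)
  then have \<kappa>: "\<bar>\<kappa>\<bar> \<le> \<bar>k\<bar>"
    unfolding \<kappa>_def abs_mult power_abs by (intro mult_right_le_one_le power_le_one) auto
  have i1: "integrable M (\<lambda>\<omega>. of_bool (X 0 \<omega> = k) * \<bar>X i \<omega>\<bar>)"
    by (rule adapted_integrable[of i]) (rule adapted_compose2[OF adapted_X[of 0] adapted_X[of i]]; simp)
  have i2: "integrable M (\<lambda>\<omega>. of_bool (X 0 \<omega> = k) * (X i \<omega> - \<kappa>)\<^sup>2)"
    by (rule adapted_integrable[of i]) (rule adapted_compose2[OF adapted_X[of 0] adapted_X[of i]]; simp)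
  have i3: "integrable M (\<lambda>\<omega>. of_bool (X 0 \<omega> = k) :: real)"
    by (rule adapted_integrable[of 0]) (rule adapted_compose2[OF adapted_X[of 0] adapted_X[of 0]]; simp)
  have le: "of_bool (X 0 \<omega> = k) * \<bar>X i \<omega>\<bar> \<le> (\<bar>k\<bar> + sqrt n / 2) * of_bool (X 0 \<omega> = k)
      + (1 / (2 * sqrt n)) * (of_bool (X 0 \<omega> = k) * (X i \<omega> - \<kappa>)\<^sup>2)" for \<omega>
  proof -
    define u where "u = X i \<omega> - \<kappa>"
    have "0 \<le> (sqrt n - \<bar>u\<bar>)\<^sup>2 / (2 * sqrt n)" using n by simp
    also have "\<dots> = sqrt n / 2 + 1 / (2 * sqrt n) * u\<^sup>2 - \<bar>u\<bar>"
      using n by (simp add: power2_eq_square field_simps)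
    finally have "\<bar>u\<bar> \<le> sqrt n / 2 + 1 / (2 * sqrt n) * u\<^sup>2" by simp
    moreover have "\<bar>X i \<omega>\<bar> \<le> \<bar>k\<bar> + \<bar>u\<bar>" using \<kappa> by (simp add: u_def)
    ultimately show ?thesis by (cases "X 0 \<omega> = k") (auto simp: u_def)
  qed
  have "expectation (\<lambda>\<omega>. of_bool (X 0 \<omega> = k) * \<bar>X i \<omega>\<bar>)
      \<le> expectation (\<lambda>\<omega>. (\<bar>k\<bar> + sqrt n / 2) * of_bool (X 0 \<omega> = k)
      + (1 / (2 * sqrt n)) * (of_bool (X 0 \<omega> = k) * (X i \<omega> - \<kappa>)\<^sup>2))"
    by (intro integral_mono i1 Bochner_Integration.integrable_add i2 integrable_mult_right i3 le)
  also have "\<dots> = (\<bar>k\<bar> + sqrt n / 2) * level_prob k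
      + (1 / (2 * sqrt n)) * expectation (\<lambda>\<omega>. of_bool (X 0 \<omega> = k) * (X i \<omega> - \<kappa>)\<^sup>2)"
    unfolding level_prob_def
    by (simp only: Bochner_Integration.integral_add integrable_mult_right i2 i3 integral_mult_right_zero)
  also have "\<dots> \<le> (\<bar>k\<bar> + sqrt n / 2) * level_prob k + (1 / (2 * sqrt n)) * (4 * (T * n) * level_prob k)"
  proof (intro add_left_mono mult_left_mono)
    show "expectation (\<lambda>\<omega>. of_bool (X 0 \<omega> = k) * (X i \<omega> - \<kappa>)\<^sup>2) \<le> 4 * (T * n) * level_prob k"
      unfolding \<kappa>_def using i level_prob_nonneg[of k]
      by (intro order_trans[OF second_moment_from_level] mult_right_mono) auto
  qed (use n in auto)
  also have "(1 / (2 * sqrt n)) * (4 * (T * n) * level_prob k) = 2 * T * sqrt n * level_prob k"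
  proof -
    have "n = sqrt n * sqrt n" using n by simp
    then show ?thesis using n by (simp add: field_simps)
  qed
  finally show ?thesis by (simp add: algebra_simps)
qed

text \<open>The Gaussian step has standard deviation \<open>2 * r\<close>, the size of a scaled step
  of the walk, so the symmetric parts agree to second order. Per step, 12 L r^3 is the bound 3/2 L
  (2r)^3 of \<open>gaussian_two_point_diff\<close>, and the term with \<open>b\<close> pays for the
  drift through the Lipschitz bound alone.\<close>

lemma lindeberg_from_level:
  fixes g :: "'c::euclidean_space \<Rightarrow> real" and D :: "nat \<Rightarrow> 'b \<Rightarrow> real"
  assumes N: "prob_space N"
    and ind: "prob_space.indep_vars N (\<lambda>_. borel) D {..<m}"
    and D: "\<And>j. j < m \<Longrightarrow> distributed N lborel (D j) (normal_density 0 (2 * r))"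
    and r: "r > 0" and L: "L \<ge> 0"
    and g: "g \<in> borel_measurable borel" "\<And>x. \<bar>g x\<bar> \<le> B"
    and reg: "\<And>j. j < m \<Longrightarrow> lindeberg_regular L (e j) g"
    and b: "\<And>j. j < m \<Longrightarrow> expectation (\<lambda>\<omega>. of_bool (X 0 \<omega> = k) * \<bar>X j \<omega>\<bar>) \<le> level_prob k * b"
  shows "\<bar>expectation (\<lambda>\<omega>. of_bool (X 0 \<omega> = k) * g (v + (\<Sum>j<m. ((X (Suc j) \<omega> - X j \<omega>) * r) *\<^sub>R e j)))
      - level_prob k * (LINT \<omega>|N. g (v + (\<Sum>j<m. D j \<omega> *\<^sub>R e j)))\<bar>
    \<le> level_prob k * (real m * (2 * L * r * b / real K + 12 * L * r ^ 3))"
proof -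
  interpret N: prob_space N by (rule N)
  have [measurable]: "D j \<in> borel_measurable N" if "j < m" for j
    using distributed_measurable[OF D[OF that]] by simp
  define S where "S i = (\<lambda>\<omega>. \<Sum>j=i..<m. D j \<omega> *\<^sub>R e j)" for i
  have S[measurable]: "S i \<in> borel_measurable N" for i
    unfolding S_def by (intro borel_measurable_sum borel_measurable_scaleR) auto
  \<comment> \<open>\<open>U i\<close> is the hybrid with the first \<open>i\<close> steps taken by
    the walk and the rest Gaussian; the Gaussians are already integrated out in \<open>H\<close>.
    The two spaces are thus never coupled.\<close>
  define H where "H i a = N.expectation (\<lambda>\<omega>. g (a + S i \<omega>))" for i a
  define A where "A i \<omega> = v + (\<Sum>j<i. ((X (Suc j) \<omega> - X j \<omega>) * r) *\<^sub>R e j)" for i \<omega>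
  define U where "U i = expectation (\<lambda>\<omega>. of_bool (X 0 \<omega> = k) * H i (A i \<omega>))" for i
  have H_meas: "H i \<in> borel_measurable borel" for i
    unfolding H_def using g(1) by measurable
  have H_bound: "\<bar>H i a\<bar> \<le> B" for i a
  proof -
    have "integrable N (\<lambda>\<omega>. g (a + S i \<omega>))"
      using g by (intro N.integrable_const_bound[of _ B]) auto
    then have "\<bar>H i a\<bar> \<le> N.expectation (\<lambda>\<omega>. B)"
      unfolding H_def using g(2)
      by (intro order_trans[OF integral_abs_bound] integral_mono) auto
    then show ?thesis by (simp add: N.prob_space)
  qed
  have H_reg: "lindeberg_regular L (e j) (H i)" if "j < m" for i j
    unfolding H_def[abs_def] by (rule N.lindeberg_regular_average[OF reg[OF that] g S])
  have A_adapted: "adapted i (A i)" for i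
    unfolding A_def[abs_def]
    by (rule adapted_compose2[where f = "X 0", OF adapted_X adapted_sum], simp)
      (rule adapted_compose2[OF adapted_X adapted_X]; simp)
  have step: "\<bar>U (Suc i) - U i\<bar> \<le> level_prob k * (2 * L * r * b / real K + 12 * L * r ^ 3)"
    if i: "i < m" for i
  proof -
    define G where "G \<omega> y = of_bool (X 0 \<omega> = k) * H (Suc i) (A i \<omega> + (- 2 * y * r) *\<^sub>R e i)" for \<omega> y
    have aG: "adapted i G" unfolding G_def[abs_def]
      by (rule adapted_compose2[OF adapted_X[of 0] A_adapted]) auto
    let ?E = "\<lambda>\<omega>. (G \<omega> 1 + G \<omega> (- 1)) / 2 + X i \<omega> / real K * ((G \<omega> 1 - G \<omega> (- 1)) / 2)"
    let ?Z = "\<lambda>\<omega>. of_bool (X 0 \<omega> = k) * H i (A i \<omega>)"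
    let ?R = "\<lambda>\<omega>. (12 * L * r ^ 3) * of_bool (X 0 \<omega> = k) + (2 * L * r / real K) * (of_bool (X 0 \<omega> = k) * \<bar>X i \<omega>\<bar>)"
    have i1: "integrable M ?E"
      by (rule adapted_integrable[of i]) (rule adapted_compose2[OF adapted_X[of i] aG], simp)
    have i2: "integrable M ?Z"
      by (rule adapted_integrable[of i]) (rule adapted_compose2[OF adapted_X[of 0] A_adapted]; simp)
    have i3: "integrable M (\<lambda>\<omega>. of_bool (X 0 \<omega> = k) :: real)"
      by (rule adapted_integrable[of 0]) (rule adapted_compose2[OF adapted_X[of 0] adapted_X[of 0]]; simp)
    have i4: "integrable M (\<lambda>\<omega>. of_bool (X 0 \<omega> = k) * \<bar>X i \<omega>\<bar>)"
      by (rule adapted_integrable[of i]) (rule adapted_compose2[OF adapted_X[of 0] adapted_X[of i]]; simp)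
    have "U (Suc i) = expectation (\<lambda>\<omega>. G \<omega> (Y i \<omega> (C i \<omega>)))"
      unfolding U_def
      by (intro Bochner_Integration.integral_cong refl) (simp add: G_def A_def X_Suc add_diff_eq)
    also have "\<dots> = expectation ?E" by (rule expectation_step[OF aG])
    finally have U: "U (Suc i) - U i = expectation (\<lambda>\<omega>. ?E \<omega> - ?Z \<omega>)"
      unfolding U_def using i1 i2 by simp
    \<comment> \<open>\<open>p\<close> and \<open>q\<close> are the values after a step up and a
      step down. Their mean differs from \<open>H i\<close> by the two-point comparison; their
      difference, at distance \<open>4 * r\<close>, is multiplied by half of X_i/K.\<close>
    have le: "\<bar>?E \<omega> - ?Z \<omega>\<bar> \<le> ?R \<omega>" for \<omega>
    proof (cases "X 0 \<omega> = k")
      case True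
      define p q where "p = H (Suc i) (A i \<omega> + (2 * r) *\<^sub>R e i)" and "q = H (Suc i) (A i \<omega> - (2 * r) *\<^sub>R e i)"
      have G: "G \<omega> 1 = q" "G \<omega> (- 1) = p" using True by (auto simp: G_def p_def q_def)
      have "H i (A i \<omega>) = N.expectation (\<lambda>\<omega>'. H (Suc i) (A i \<omega> + D i \<omega>' *\<^sub>R e i))"
        unfolding H_def S_def by (rule N.indep_sum_split[OF ind i g])
      then have "\<bar>H i (A i \<omega>) - (p + q) / 2\<bar> \<le> 3 / 2 * L * (2 * r) ^ 3"
        unfolding p_def q_def using r
        by (simp only:) (rule N.gaussian_two_point_diff[OF D[OF i] _ H_reg[OF i] H_meas H_bound L], simp)
      then have 1: "\<bar>(q + p) / 2 - H i (A i \<omega>)\<bar> \<le> 12 * L * r ^ 3"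
        by (simp add: power_mult_distrib abs_minus_commute add.commute)
      have "\<bar>H (Suc i) ((A i \<omega> - (2 * r) *\<^sub>R e i) + (4 * r) *\<^sub>R e i) - H (Suc i) (A i \<omega> - (2 * r) *\<^sub>R e i)\<bar>
          \<le> L * \<bar>4 * r\<bar>"
        by (rule lindeberg_regular_lipschitz[OF H_reg[OF i]])
      moreover have "(A i \<omega> - (2 * r) *\<^sub>R e i) + (4 * r) *\<^sub>R e i = A i \<omega> + (2 * r) *\<^sub>R e i"
        by (simp add: algebra_simps flip: scaleR_left_distrib)
      ultimately have "\<bar>q - p\<bar> \<le> 4 * L * r" using r by (simp add: p_def q_def abs_mult)
      then have "\<bar>X i \<omega>\<bar> / real K * (\<bar>q - p\<bar> / 2) \<le> \<bar>X i \<omega>\<bar> / real K * ((4 * L * r) / 2)"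
        by (intro mult_left_mono divide_right_mono) auto
      then have 2: "\<bar>X i \<omega> / real K * ((q - p) / 2)\<bar> \<le> 2 * L * r / real K * \<bar>X i \<omega>\<bar>"
        by (simp add: abs_mult mult_ac)
      have "\<bar>(q + p) / 2 + X i \<omega> / real K * ((q - p) / 2) - H i (A i \<omega>)\<bar>
          \<le> 12 * L * r ^ 3 + 2 * L * r / real K * \<bar>X i \<omega>\<bar>"
        using 1 2 by linarith
      then show ?thesis unfolding G using True by simp
    qed (simp add: G_def)
    have "\<bar>U (Suc i) - U i\<bar> \<le> expectation (\<lambda>\<omega>. \<bar>?E \<omega> - ?Z \<omega>\<bar>)"
      unfolding U by (rule integral_abs_bound)
    also have "\<dots> \<le> expectation ?R"
      using i1 i2 i3 i4 le by (intro integral_mono) auto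
    also have "\<dots> = (12 * L * r ^ 3) * level_prob k
        + (2 * L * r / real K) * expectation (\<lambda>\<omega>. of_bool (X 0 \<omega> = k) * \<bar>X i \<omega>\<bar>)"
      unfolding level_prob_def
      by (simp only: Bochner_Integration.integral_add integrable_mult_right i3 i4 integral_mult_right_zero)
    also have "\<dots> \<le> (12 * L * r ^ 3) * level_prob k + (2 * L * r / real K) * (level_prob k * b)"
      using L r by (intro add_left_mono mult_left_mono b i) auto
    also have "\<dots> = level_prob k * (2 * L * r * b / real K + 12 * L * r ^ 3)"
      by (simp add: algebra_simps)
    finally show ?thesis .
  qed
  have "\<bar>U i - U 0\<bar> \<le> real i * (level_prob k * (2 * L * r * b / real K + 12 * L * r ^ 3))" if "i \<le> m" for i
    using that
  proof (induction i)
    case (Suc i)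
    then have "\<bar>U i - U 0\<bar> \<le> real i * (level_prob k * (2 * L * r * b / real K + 12 * L * r ^ 3))" by simp
    then show ?case using step[of i] Suc.prems by (simp add: distrib_right)
  qed simp
  from this[of m] have "\<bar>U m - U 0\<bar> \<le> real m * (level_prob k * (2 * L * r * b / real K + 12 * L * r ^ 3))"
    by simp
  moreover have "U m = expectation (\<lambda>\<omega>. of_bool (X 0 \<omega> = k) * g (v + (\<Sum>j<m. ((X (Suc j) \<omega> - X j \<omega>) * r) *\<^sub>R e j)))"
    by (simp add: U_def H_def S_def A_def N.prob_space)
  moreover have "U 0 = level_prob k * (LINT \<omega>|N. g (v + (\<Sum>j<m. D j \<omega> *\<^sub>R e j)))"
    by (simp add: U_def H_def S_def A_def level_prob_def atLeast0LessThan)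
  ultimately show ?thesis by (simp add: mult_ac)
qed

text \<open>Chebyshev with the weight taken inside the expectation. If the mean has kept at least
  half of \<open>k\<close> and the walk ends within R sqrt(n), then |k| is at most 2(|u| + R sqrt n)
  with u the deviation from the mean, so k^2/n is at most 8R^2 + 8u^2/n. The second moment bound
  turns the last term into 32T.\<close>

lemma level_tail_bound:
  fixes n T R :: real
  assumes n: "n > 0" and m: "real m \<le> T * n" and half: "(1 - 2 / real K) ^ m \<ge> 1 / 2"
    and Z: "integrable M Z" "\<And>\<omega>. \<omega> \<in> space M \<Longrightarrow> \<bar>Z \<omega>\<bar> \<le> B * of_bool (\<bar>X m \<omega>\<bar> \<le> R * sqrt n)"
    and B: "B \<ge> 0"
  shows "\<bar>expectation (\<lambda>\<omega>. of_bool (X 0 \<omega> = k) * Z \<omega>)\<bar> * (1 + k\<^sup>2 / n)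
    \<le> B * (1 + 8 * R\<^sup>2 + 32 * T) * level_prob k"
proof -
  define \<rho> where "\<rho> = (1 - 2 / real K) ^ m"
  have i2: "integrable M (\<lambda>\<omega>. of_bool (X 0 \<omega> = k) * (X m \<omega> - k * \<rho>)\<^sup>2)"
    by (rule adapted_integrable[of m]) (rule adapted_compose2[OF adapted_X[of 0] adapted_X[of m]]; simp)
  have i3: "integrable M (\<lambda>\<omega>. of_bool (X 0 \<omega> = k) :: real)"
    by (rule adapted_integrable[of 0]) (rule adapted_compose2[OF adapted_X[of 0] adapted_X[of 0]]; simp)
  have i1: "integrable M (\<lambda>\<omega>. \<bar>of_bool (X 0 \<omega> = k) * Z \<omega>\<bar>)"
  proof (rule Bochner_Integration.integrable_bound[OF Z(1)])
    show "(\<lambda>\<omega>. \<bar>of_bool (X 0 \<omega> = k) * Z \<omega>\<bar>) \<in> borel_measurable M"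
      using Z(1) i3 by (intro borel_measurable_abs borel_measurable_times) auto
  qed (auto simp: abs_mult)
  let ?R = "\<lambda>\<omega>. (B * (1 + 8 * R\<^sup>2)) * of_bool (X 0 \<omega> = k) + (8 * B / n) * (of_bool (X 0 \<omega> = k) * (X m \<omega> - k * \<rho>)\<^sup>2)"
  have le: "\<bar>of_bool (X 0 \<omega> = k) * Z \<omega>\<bar> * (1 + k\<^sup>2 / n) \<le> ?R \<omega>" if \<omega>: "\<omega> \<in> space M" for \<omega>
  proof (cases "X 0 \<omega> = k \<and> \<bar>X m \<omega>\<bar> \<le> R * sqrt n")
    case True
    define u where "u = X m \<omega> - k * \<rho>"
    have "\<bar>k\<bar> * (1 / 2) \<le> \<bar>k\<bar> * \<rho>" using half unfolding \<rho>_def by (intro mult_left_mono) auto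
    also have "\<dots> = \<bar>k * \<rho>\<bar>" using half unfolding \<rho>_def by (simp add: abs_mult)
    also have "\<dots> \<le> \<bar>u\<bar> + R * sqrt n" unfolding u_def using True by linarith
    finally have "\<bar>k\<bar> \<le> 2 * (\<bar>u\<bar> + R * sqrt n)" by simp
    then have "\<bar>k\<bar>\<^sup>2 \<le> (2 * (\<bar>u\<bar> + R * sqrt n))\<^sup>2" by (intro power_mono) auto
    also have "\<dots> \<le> 8 * u\<^sup>2 + 8 * R\<^sup>2 * (sqrt n)\<^sup>2"
    proof -
      have "(2 * (a + b))\<^sup>2 \<le> 8 * a\<^sup>2 + 8 * b\<^sup>2" for a b :: real
        using zero_le_power2[of "a - b"] by (simp add: power2_eq_square algebra_simps)
      from this[of "\<bar>u\<bar>" "R * sqrt n"] show ?thesis by (simp add: power_mult_distrib)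
    qed
    finally have "k\<^sup>2 \<le> 8 * u\<^sup>2 + 8 * R\<^sup>2 * n" using n by simp
    then have "k\<^sup>2 / n \<le> (8 * u\<^sup>2 + 8 * R\<^sup>2 * n) / n" using n by (intro divide_right_mono) auto
    then have "1 + k\<^sup>2 / n \<le> 1 + 8 * R\<^sup>2 + 8 / n * u\<^sup>2" using n by (simp add: add_divide_distrib)
    moreover have "\<bar>Z \<omega>\<bar> \<le> B" using Z(2)[OF \<omega>] True by simp
    ultimately have "\<bar>Z \<omega>\<bar> * (1 + k\<^sup>2 / n) \<le> B * (1 + 8 * R\<^sup>2 + 8 / n * u\<^sup>2)"
      using B n by (intro mult_mono) auto
    then show ?thesis using True by (simp add: u_def algebra_simps)
  next
    case False
    then have "of_bool (X 0 \<omega> = k) * Z \<omega> = 0" using Z(2)[OF \<omega>] by auto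
    then show ?thesis using B n by auto
  qed
  have "\<bar>expectation (\<lambda>\<omega>. of_bool (X 0 \<omega> = k) * Z \<omega>)\<bar> * (1 + k\<^sup>2 / n)
      \<le> expectation (\<lambda>\<omega>. \<bar>of_bool (X 0 \<omega> = k) * Z \<omega>\<bar>) * (1 + k\<^sup>2 / n)"
    using n by (intro mult_right_mono integral_abs_bound) auto
  also have "\<dots> = expectation (\<lambda>\<omega>. \<bar>of_bool (X 0 \<omega> = k) * Z \<omega>\<bar> * (1 + k\<^sup>2 / n))"
    by simp
  also have "\<dots> \<le> expectation ?R"
    using i1 i2 i3 le by (intro integral_mono) auto
  also have "\<dots> = (B * (1 + 8 * R\<^sup>2)) * level_prob k
      + (8 * B / n) * expectation (\<lambda>\<omega>. of_bool (X 0 \<omega> = k) * (X m \<omega> - k * \<rho>)\<^sup>2)"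
    unfolding level_prob_def
    by (simp only: Bochner_Integration.integral_add integrable_mult_right i2 i3 integral_mult_right_zero)
  also have "\<dots> \<le> (B * (1 + 8 * R\<^sup>2)) * level_prob k + (8 * B / n) * (4 * (T * n) * level_prob k)"
  proof (intro add_left_mono mult_left_mono)
    show "expectation (\<lambda>\<omega>. of_bool (X 0 \<omega> = k) * (X m \<omega> - k * \<rho>)\<^sup>2) \<le> 4 * (T * n) * level_prob k"
      unfolding \<rho>_def using m level_prob_nonneg[of k]
      by (intro order_trans[OF second_moment_from_level] mult_right_mono) auto
  qed (use n B in auto)
  also have "\<dots> = B * (1 + 8 * R\<^sup>2 + 32 * T) * level_prob k"
    using n by (simp add: field_simps)
  finally show ?thesis .
qed

end

subsection \<open>Passing to the limit\<close>

lemma borel_measurable_vec_lambda: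
  fixes f :: "'n::finite \<Rightarrow> 'a \<Rightarrow> real"
  assumes "\<And>i. f i \<in> borel_measurable M"
  shows "(\<lambda>\<omega>. \<chi> i. f i \<omega>) \<in> borel_measurable M"
proof (subst borel_measurable_euclidean_space, rule ballI)
  fix b :: "real^'n" assume "b \<in> Basis"
  then obtain i where "b = axis i 1" by (auto simp: Basis_vec_def)
  then have "(\<lambda>\<omega>. (\<chi> i. f i \<omega>) \<bullet> b) = f i" by (simp add: inner_axis)
  then show "(\<lambda>\<omega>. (\<chi> i. f i \<omega>) \<bullet> b) \<in> borel_measurable M" using assms[of i] by simp
qed

context uniform_hypercube_walk
begin

text \<open>Each coordinate telescopes. \<open>Y'\<close> is a family indexed by the dimension, as
  in \<open>walk_Z\<close>, while the locale knows a single walk; \<open>Y' K = Y\<close> links the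
  two.\<close>

lemma walk_vector_eq:
  fixes t :: "'s::finite \<Rightarrow> real"
  assumes Y: "Y' K = Y" and S: "\<And>i. nat \<lfloor>real n * t i\<rfloor> \<le> S"
  shows "(\<chi> i. if i = i0 then walk_Z Y' n K (t i) \<omega> else walk_dZ Y' n K (t i) \<omega>)
    = (X 0 \<omega> / sqrt (real n)) *\<^sub>R axis i0 1
      + (\<Sum>j<S. ((X (Suc j) \<omega> - X j \<omega>) * (1 / sqrt (real n))) *\<^sub>R
           (\<chi> i. of_bool (j < nat \<lfloor>real n * t i\<rfloor>)))" (is "?l = ?r")
  unfolding vec_eq_iff
proof
  fix i
  have "(\<Sum>j<S. (X (Suc j) \<omega> - X j \<omega>) * (1 / sqrt (real n)) * of_bool (j < nat \<lfloor>real n * t i\<rfloor>))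
      = (\<Sum>j<nat \<lfloor>real n * t i\<rfloor>. (X (Suc j) \<omega> - X j \<omega>) * (1 / sqrt (real n)))"
    using S[of i] by (intro sum.mono_neutral_cong_right) auto
  also have "\<dots> = (X (nat \<lfloor>real n * t i\<rfloor>) \<omega> - X 0 \<omega>) * (1 / sqrt (real n))"
    by (simp only: sum_distrib_right[symmetric] sum_lessThan_telescope[of "\<lambda>j. X j \<omega>"])
  finally show "?l $ i = ?r $ i"
    by (auto simp: sum_component walk_Z_def walk_dZ_def walk_X_def Y X_def axis_def diff_divide_distrib)
qed

lemma expectation_levels:
  fixes Z :: "'a \<Rightarrow> real"
  assumes "integrable M Z"
  shows "expectation Z = (\<Sum>j\<le>K. expectation (\<lambda>\<omega>. of_bool (X 0 \<omega> = 2 * real j - real K) * Z \<omega>))"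
proof -
  have int: "integrable M (\<lambda>\<omega>. of_bool (X 0 \<omega> = k) * Z \<omega>)" for k
  proof (rule Bochner_Integration.integrable_bound[OF assms])
    have "integrable M (\<lambda>\<omega>. of_bool (X 0 \<omega> = k) :: real)"
      by (rule adapted_integrable[of 0]) (rule adapted_compose2[OF adapted_X[of 0] adapted_X[of 0]]; simp)
    then show "(\<lambda>\<omega>. of_bool (X 0 \<omega> = k) * Z \<omega>) \<in> borel_measurable M"
      using assms by (intro borel_measurable_times) auto
  qed (auto simp: abs_mult)
  have "Z \<omega> = (\<Sum>j\<le>K. of_bool (X 0 \<omega> = 2 * real j - real K) * Z \<omega>)" if \<omega>: "\<omega> \<in> space M" for \<omega>
  proof -
    let ?S = "{c \<in> {1..K}. Y 0 \<omega> c = 1}"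
    have "X 0 \<omega> = (\<Sum>c=1..K. 2 * of_bool (Y 0 \<omega> c = 1) - 1)"
      unfolding X_def coord_sum_def
    proof (rule sum.cong)
      fix c assume "c \<in> {1..K}"
      then show "Y 0 \<omega> c = 2 * of_bool (Y 0 \<omega> c = 1) - 1"
        by (cases rule: hypercube_cases[OF Y_in[OF \<omega>, of 0]]) auto
    qed simp
    also have "\<dots> = 2 * real (card ?S) - real K"
      by (simp add: sum_subtractf Int_def flip: sum_distrib_left)
    \<comment> \<open>Hence exactly one summand survives, the one whose index is the number of
      coordinates equal to 1.\<close>
    finally have X0: "X 0 \<omega> = 2 * real (card ?S) - real K" .
    have "card ?S \<le> card {1..K}" by (rule card_mono) auto
    then have "card ?S \<le> K" by simp
    have "(\<Sum>j\<le>K. of_bool (X 0 \<omega> = 2 * real j - real K) * Z \<omega>)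
        = (\<Sum>j\<le>K. if j = card ?S then Z \<omega> else 0)"
      unfolding X0 by (intro sum.cong) auto
    also have "\<dots> = Z \<omega>" using \<open>card ?S \<le> K\<close> by (simp add: sum.delta)
    finally show ?thesis by simp
  qed
  then have "expectation Z = expectation (\<lambda>\<omega>. \<Sum>j\<le>K. of_bool (X 0 \<omega> = 2 * real j - real K) * Z \<omega>)"
    by (intro Bochner_Integration.integral_cong) auto
  also have "\<dots> = (\<Sum>j\<le>K. expectation (\<lambda>\<omega>. of_bool (X 0 \<omega> = 2 * real j - real K) * Z \<omega>))"
    by (rule Bochner_Integration.integral_sum) (rule int)
  finally show ?thesis .
qed

end

section \<open>Fubini and translation, discretised Brownian motion, Riemann sums\<close>

lemma Fubini_window:
  fixes f :: "'b \<Rightarrow> real \<Rightarrow> real"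
  assumes N: "prob_space N" and f: "case_prod f \<in> borel_measurable (N \<Otimes>\<^sub>M lborel)"
    and bound: "\<And>\<omega> x. \<bar>f \<omega> x\<bar> \<le> B * indicator {u \<omega> - R..u \<omega> + R} x" and R: "R \<ge> 0"
  shows "(LINT x|lborel. LINT \<omega>|N. f \<omega> x) = (LINT \<omega>|N. LINT x|lborel. f \<omega> x)"
proof -
  interpret N: prob_space N by (rule N)
  interpret P: pair_sigma_finite N lborel ..
  have b: "integrable lborel (\<lambda>x. B * indicator {u \<omega> - R..u \<omega> + R} x)" for \<omega>
    using R by (intro integrable_mult_right integrable_real_indicator) auto
  have f_meas: "f \<omega> \<in> borel_measurable borel" if "\<omega> \<in> space N" for \<omega>
    using measurable_Pair2[OF f that] by simp
  have i: "integrable lborel (f \<omega>)" if "\<omega> \<in> space N" for \<omega>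
    using bound[of \<omega>] f_meas[OF that]
    by (intro Bochner_Integration.integrable_bound[OF b[of \<omega>]]) (auto intro: order_trans[OF _ abs_ge_self])
  \<comment> \<open>The window has length 2R wherever it is centred, so the bound is uniform in
    \<open>\<omega>\<close> although the centre \<open>u \<omega>\<close> moves; on a probability
    space that yields joint integrability.\<close>
  have le: "(LINT x|lborel. norm (f \<omega> x)) \<le> B * (2 * R)" if "\<omega> \<in> space N" for \<omega>
  proof -
    have "(LINT x|lborel. norm (f \<omega> x)) \<le> (LINT x|lborel. B * indicator {u \<omega> - R..u \<omega> + R} x)"
      using bound i[OF that] by (intro integral_mono b) auto
    also have "\<dots> = B * (2 * R)" using R by simp
    finally show ?thesis .
  qed
  have "integrable (N \<Otimes>\<^sub>M lborel) (case_prod f)"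
  proof (rule P.Fubini_integrable[OF f])
    show "integrable N (\<lambda>\<omega>. LINT x|lborel. norm (case_prod f (\<omega>, x)))"
    proof (rule N.integrable_const_bound[of _ "B * (2 * R)"])
      show "AE \<omega> in N. norm (LINT x|lborel. norm (case_prod f (\<omega>, x))) \<le> B * (2 * R)"
        using le by (intro AE_I2) simp
      show "(\<lambda>\<omega>. LINT x|lborel. norm (case_prod f (\<omega>, x))) \<in> borel_measurable N"
        using f by measurable
    qed
  qed (use i in \<open>auto intro!: AE_I2\<close>)
  then show ?thesis by (rule P.Fubini_integral)
qed

text \<open>The translation by \<open>V i0 \<omega>\<close> is random, so it is possible only with
  the Lebesgue integral innermost. This forces the exchange of integrals before and after
  it.\<close>

lemma integral_translate_coordinate:
  fixes \<phi> :: "real^'s::finite \<Rightarrow> real" and V :: "'s \<Rightarrow> 'b \<Rightarrow> real"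
  assumes N: "prob_space N" and \<phi>: "\<phi> \<in> borel_measurable borel"
    and V: "\<And>i. V i \<in> borel_measurable N"
    and bound: "\<And>x. \<bar>\<phi> x\<bar> \<le> B * of_bool (\<bar>x $ i0\<bar> \<le> R)" and R: "R \<ge> 0"
  shows "(LINT x|lborel. LINT \<omega>|N. \<phi> (x *\<^sub>R axis i0 1 + (\<chi> i. V i \<omega>)))
    = (LINT x|lborel. LINT \<omega>|N. \<phi> (\<chi> i. if i = i0 then x else V i \<omega>))"
proof -
  note V[measurable]
  let ?f = "\<lambda>\<omega> x. \<phi> (x *\<^sub>R axis i0 1 + (\<chi> i. V i \<omega>))"
  let ?g = "\<lambda>\<omega> x. \<phi> (\<chi> i. if i = i0 then x else V i \<omega>)"
  have "(LINT x|lborel. LINT \<omega>|N. ?f \<omega> x) = (LINT \<omega>|N. LINT x|lborel. ?f \<omega> x)"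
  proof (rule Fubini_window[OF N _ _ R, where u = "\<lambda>\<omega>. - V i0 \<omega>" and B = B])
    have "(\<lambda>p. snd p *\<^sub>R axis i0 1 + (\<chi> i. V i (fst p))) \<in> borel_measurable (N \<Otimes>\<^sub>M lborel)"
      by (intro borel_measurable_add borel_measurable_scaleR borel_measurable_vec_lambda) simp_all
    from measurable_compose[OF this \<phi>]
    show "case_prod ?f \<in> borel_measurable (N \<Otimes>\<^sub>M lborel)" by (simp add: case_prod_beta')
    show "\<bar>?f \<omega> x\<bar> \<le> B * indicator {- V i0 \<omega> - R..- V i0 \<omega> + R} x" for \<omega> x
      by (rule order_trans[OF bound]) (auto simp: axis_def indicator_def abs_le_iff)
  qed
  also have "\<dots> = (LINT \<omega>|N. LINT x|lborel. ?g \<omega> x)"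
  proof (rule Bochner_Integration.integral_cong[OF refl])
    fix \<omega>
    have "x *\<^sub>R axis i0 1 + (\<chi> i. V i \<omega>) = (\<chi> i. if i = i0 then V i0 \<omega> + 1 * x else V i \<omega>)" for x
      by (simp add: vec_eq_iff axis_def)
    then show "(LINT x|lborel. ?f \<omega> x) = (LINT x|lborel. ?g \<omega> x)"
      using lborel_integral_real_affine[of 1 "?g \<omega>" "V i0 \<omega>"] by simp
  qed
  also have "\<dots> = (LINT x|lborel. LINT \<omega>|N. ?g \<omega> x)"
  proof (rule Fubini_window[OF N _ _ R, where u = "\<lambda>\<omega>. 0" and B = B, symmetric])
    have "(\<lambda>p. \<chi> i. if i = i0 then snd p else V i (fst p)) \<in> borel_measurable (N \<Otimes>\<^sub>M lborel)"
      by (intro borel_measurable_vec_lambda) simp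
    from measurable_compose[OF this \<phi>]
    show "case_prod ?g \<in> borel_measurable (N \<Otimes>\<^sub>M lborel)" by (simp add: case_prod_beta')
    show "\<bar>?g \<omega> x\<bar> \<le> B * indicator {0 - R..0 + R} x" for \<omega> x
      by (rule order_trans[OF bound]) (auto simp: indicator_def abs_le_iff)
  qed
  finally show ?thesis .
qed

text \<open>Path continuity gives pointwise convergence and the bound \<open>B\<close> dominates.
  The starting point \<open>y n\<close> may vary because a level never sits exactly at
  \<open>x\<close>; subtracting \<open>W 0\<close>, which vanishes only almost surely, is what the
  telescoped increments produce.\<close>

lemma brownian_discretization_limit:
  fixes \<phi> :: "real^'s::finite \<Rightarrow> real" and t :: "'s \<Rightarrow> real"
  assumes BM: "standard_brownian_motion N W" and t: "\<And>i. 0 \<le> t i"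
    and \<phi>: "continuous_on UNIV \<phi>" "\<And>x. \<bar>\<phi> x\<bar> \<le> B"
    and y: "y \<longlonglongrightarrow> x"
  shows "(\<lambda>n. LINT \<omega>|N. \<phi> (y n *\<^sub>R axis i0 1 +
        (\<chi> i. 2 * (W (real (nat \<lfloor>real n * t i\<rfloor>) / real n) \<omega> - W 0 \<omega>))))
    \<longlonglongrightarrow> (LINT \<omega>|N. \<phi> (x *\<^sub>R axis i0 1 + (\<chi> i. 2 * W (t i) \<omega>)))"
proof -
  interpret N: prob_space N using BM by (simp add: standard_brownian_motion_def)
  have W[measurable]: "W s \<in> borel_measurable N" if "s \<ge> 0" for s
    using BM that by (simp add: standard_brownian_motion_def)
  have \<phi>_meas: "\<phi> \<in> borel_measurable borel" by (rule borel_measurable_continuous_onI[OF \<phi>(1)])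
  have lim_t: "(\<lambda>n. real (nat \<lfloor>real n * t i\<rfloor>) / real n) \<longlonglongrightarrow> t i" for i
  proof (rule tendsto_sandwich)
    have "(\<lambda>n. t i - 1 / real n) \<longlonglongrightarrow> t i - 0"
      by (intro tendsto_diff tendsto_const lim_1_over_n)
    then show "(\<lambda>n. t i - 1 / real n) \<longlonglongrightarrow> t i" by simp
    show "\<forall>\<^sub>F n in sequentially. t i - 1 / real n \<le> real (nat \<lfloor>real n * t i\<rfloor>) / real n"
    proof (rule eventually_sequentiallyI[of 1])
      fix n :: nat assume n: "1 \<le> n"
      have "(real n * t i - 1) / real n \<le> real (nat \<lfloor>real n * t i\<rfloor>) / real n"
        by (intro divide_right_mono) linarith+
      then show "t i - 1 / real n \<le> real (nat \<lfloor>real n * t i\<rfloor>) / real n"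
        using n by (simp add: diff_divide_distrib)
    qed
    show "\<forall>\<^sub>F n in sequentially. real (nat \<lfloor>real n * t i\<rfloor>) / real n \<le> t i"
    proof (rule eventually_sequentiallyI[of 1])
      fix n :: nat assume n: "1 \<le> n"
      have "real (nat \<lfloor>real n * t i\<rfloor>) \<le> real n * t i" using t[of i] by simp
      then show "real (nat \<lfloor>real n * t i\<rfloor>) / real n \<le> t i" using n by (simp add: field_simps)
    qed
  qed simp
  show ?thesis
  proof (rule integral_dominated_convergence[where w = "\<lambda>_. B"])
    show "(\<lambda>\<omega>. \<phi> (x *\<^sub>R axis i0 1 + (\<chi> i. 2 * W (t i) \<omega>))) \<in> borel_measurable N"
      using t by (intro measurable_compose[OF _ \<phi>_meas] borel_measurable_add borel_measurable_vec_lambda) auto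
    show "(\<lambda>\<omega>. \<phi> (y n *\<^sub>R axis i0 1 + (\<chi> i. 2 * (W (real (nat \<lfloor>real n * t i\<rfloor>) / real n) \<omega> - W 0 \<omega>))))
        \<in> borel_measurable N" for n
      by (intro measurable_compose[OF _ \<phi>_meas] borel_measurable_add borel_measurable_vec_lambda) auto
    have "AE \<omega> in N. W 0 \<omega> = 0" "AE \<omega> in N. continuous_on {0..} (\<lambda>t. W t \<omega>)"
      using BM by (auto simp: standard_brownian_motion_def)
    then show "AE \<omega> in N. (\<lambda>n. \<phi> (y n *\<^sub>R axis i0 1 + (\<chi> i. 2 * (W (real (nat \<lfloor>real n * t i\<rfloor>) / real n) \<omega> - W 0 \<omega>))))
        \<longlonglongrightarrow> \<phi> (x *\<^sub>R axis i0 1 + (\<chi> i. 2 * W (t i) \<omega>))"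
    proof eventually_elim
      case (elim \<omega>)
      have "(\<lambda>n. W (real (nat \<lfloor>real n * t i\<rfloor>) / real n) \<omega>) \<longlonglongrightarrow> W (t i) \<omega>" for i
        using t[of i] by (intro continuous_on_tendsto_compose[OF elim(2) lim_t]) auto
      then have "(\<lambda>n. y n *\<^sub>R axis i0 1 + (\<chi> i. 2 * (W (real (nat \<lfloor>real n * t i\<rfloor>) / real n) \<omega> - W 0 \<omega>)))
          \<longlonglongrightarrow> x *\<^sub>R axis i0 1 + (\<chi> i. 2 * (W (t i) \<omega> - 0))"
        unfolding elim(1) by (intro tendsto_intros y)
      from continuous_on_tendsto_compose[OF \<phi>(1) this] show ?case by simp
    qed
  qed (auto intro: \<phi>(2))
qed

text \<open>With \<open>a\<close> the dimension and \<open>s\<close> the square root of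
  \<open>n\<close>, the left end of cell \<open>j\<close> is the rescaled level. The sum over levels
  becomes an honest integral over the line, accessible to dominated convergence, and the floor
  recovers the cell of a point.\<close>

lemma step_function_integral:
  fixes c :: "nat \<Rightarrow> real" and s a :: real and K :: nat
  assumes s: "s > 0"
  defines "G \<equiv> \<lambda>x. \<Sum>j\<le>K. c j * indicator {(2 * real j - a) / s ..< (2 * real j + 2 - a) / s} x"
  shows "(LINT x|lborel. G x) = 2 / s * (\<Sum>j\<le>K. c j)"
    and "G x = (if 0 \<le> \<lfloor>(x * s + a) / 2\<rfloor> \<and> \<lfloor>(x * s + a) / 2\<rfloor> \<le> int K then c (nat \<lfloor>(x * s + a) / 2\<rfloor>) else 0)"
proof -
  have le: "(2 * real j - a) / s \<le> (2 * real j + 2 - a) / s" for j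
    using s by (intro divide_right_mono) auto
  have "integrable lborel (\<lambda>x. c j * indicator {(2 * real j - a) / s ..< (2 * real j + 2 - a) / s} x)" for j
    using le by (intro integrable_mult_right integrable_real_indicator) auto
  then have "(LINT x|lborel. G x)
      = (\<Sum>j\<le>K. LINT x|lborel. c j * indicator {(2 * real j - a) / s ..< (2 * real j + 2 - a) / s} x)"
    unfolding G_def by (intro Bochner_Integration.integral_sum) auto
  also have "\<dots> = (\<Sum>j\<le>K. c j * (2 / s))"
    using le s by (intro sum.cong refl) (simp add: measure_def field_simps flip: diff_divide_distrib)
  finally show "(LINT x|lborel. G x) = 2 / s * (\<Sum>j\<le>K. c j)"
    by (simp only: sum_distrib_right[symmetric] mult.commute[of "2 / s"])
  define z where "z = \<lfloor>(x * s + a) / 2\<rfloor>"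
  have ind: "x \<in> {(2 * real j - a) / s ..< (2 * real j + 2 - a) / s} \<longleftrightarrow> int j = z" for j
  proof -
    have "x \<in> {(2 * real j - a) / s ..< (2 * real j + 2 - a) / s}
        \<longleftrightarrow> real_of_int (int j) \<le> (x * s + a) / 2 \<and> (x * s + a) / 2 < real_of_int (int j) + 1"
      using s by (auto simp: field_simps)
    then show ?thesis unfolding z_def by (metis floor_eq_iff)
  qed
  have "G x = (\<Sum>j\<le>K. if int j = z then c j else 0)"
    unfolding G_def indicator_def ind by (intro sum.cong) auto
  also have "\<dots> = (if 0 \<le> z \<and> z \<le> int K then c (nat z) else 0)"
  proof (cases "0 \<le> z \<and> z \<le> int K")
    case True
    then have "(\<Sum>j\<le>K. if int j = z then c j else 0) = (\<Sum>j\<le>K. if j = nat z then c j else 0)"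
      by (intro sum.cong) auto
    then show ?thesis using True by (simp add: sum.delta nat_le_iff)
  qed (auto intro!: sum.neutral)
  finally show "G x = (if 0 \<le> \<lfloor>(x * s + a) / 2\<rfloor> \<and> \<lfloor>(x * s + a) / 2\<rfloor> \<le> int K
      then c (nat \<lfloor>(x * s + a) / 2\<rfloor>) else 0)" unfolding z_def .
qed

section \<open>The contribution of a single starting level\<close>

definition level_term ::
  "'a measure \<Rightarrow> (nat \<Rightarrow> nat \<Rightarrow> 'a \<Rightarrow> (nat \<Rightarrow> real)) \<Rightarrow> nat \<Rightarrow> nat \<Rightarrow>
    ('s::{finite,linorder} \<Rightarrow> real) \<Rightarrow> ((real, 's) vec \<Rightarrow> real) \<Rightarrow> nat \<Rightarrow> real" where
  "level_term M Y n K t \<phi> j = (LINT \<omega>|M. of_bool (coord_sum K (Y K 0 \<omega>) = 2 * real j - real K) *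
     \<phi> (\<chi> i. if i = Min UNIV then walk_Z Y n K (t i) \<omega> else walk_dZ Y n K (t i) \<omega>))"

text \<open>The witness \<open>C\<close> depends on the dimension. The locale is therefore entered
  only inside proofs, and the facts used along the sequence K(n) speak of \<open>M\<close>,
  \<open>Y\<close> and \<open>level_term\<close> alone.\<close>

lemma hypercube_walk_imp_uniform_hypercube_walk:
  assumes "hypercube_walk M K (uniform_count_measure (hypercube K)) Y" "K \<ge> 1"
  obtains C where "uniform_hypercube_walk M K Y C"
proof -
  interpret prob_space M using assms(1) by (simp add: hypercube_walk_def)
  from assms(1) obtain C where "\<forall>i.
        C i \<in> M \<rightarrow>\<^sub>M count_space {1..K} \<and>
        distr M (count_space {1..K}) (C i) = uniform_count_measure {1..K} \<and>
        indep_set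
          (sets (vimage_algebra (space M) (C i) (count_space {1..K})))
          (sets (vimage_algebra (space M) (\<lambda>\<omega>. \<lambda>j\<in>{..i}. Y j \<omega>)
             (Pi\<^sub>M {..i} (\<lambda>_. count_space (hypercube K))))) \<and>
        (\<forall>\<omega>\<in>space M. Y (Suc i) \<omega> = flip (C i \<omega>) (Y i \<omega>))"
    unfolding hypercube_walk_def by blast
  then have "uniform_hypercube_walk M K Y C"
    using assms by unfold_locales (auto simp: hypercube_walk_def)
  then show thesis by (rule that)
qed

lemma real_nat_floor_le:
  fixes s T :: real
  assumes "0 \<le> s" "s \<le> T"
  shows "real (nat \<lfloor>real n * s\<rfloor>) \<le> T * real n"
proof -
  have "real (nat \<lfloor>real n * s\<rfloor>) \<le> real n * s" using assms(1) by simp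
  also have "\<dots> \<le> real n * T" using assms(2) by (intro mult_left_mono) auto
  finally show ?thesis by (simp add: mult.commute)
qed

context
  fixes M :: "'a measure" and Y :: "nat \<Rightarrow> nat \<Rightarrow> 'a \<Rightarrow> (nat \<Rightarrow> real)" and n K :: nat
    and t :: "'s::{finite,linorder} \<Rightarrow> real" and \<phi> :: "(real, 's) vec \<Rightarrow> real" and T B :: real
  assumes walk: "hypercube_walk M K (uniform_count_measure (hypercube K)) (Y K)"
    and K: "K \<ge> 1" and n: "n \<ge> 1"
    and t: "\<And>i. 0 \<le> t i" "\<And>i. t i \<le> T"
    and \<phi>: "\<phi> \<in> borel_measurable borel" "\<And>x. \<bar>\<phi> x\<bar> \<le> B"
begin

lemma walk_vector_integrable:
  "integrable M (\<lambda>\<omega>. \<phi> (\<chi> i. if i = Min UNIV then walk_Z Y n K (t i) \<omega> else walk_dZ Y n K (t i) \<omega>))"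
proof -
  from walk K obtain C where "uniform_hypercube_walk M K (Y K) C"
    by (rule hypercube_walk_imp_uniform_hypercube_walk)
  then interpret uniform_hypercube_walk M K "Y K" C .
  show ?thesis
  proof (rule adapted_integrable[of "nat \<lfloor>real n * T\<rfloor>"], unfold adapted_def, intro ballI impI)
    fix \<omega> \<omega>' assume "\<forall>j\<le>nat \<lfloor>real n * T\<rfloor>. Y K j \<omega> = Y K j \<omega>'"
    note Y = this[rule_format]
    have "Y K (nat \<lfloor>real n * t i\<rfloor>) \<omega> = Y K (nat \<lfloor>real n * t i\<rfloor>) \<omega>'" for i
      using t(2)[of i] by (intro Y nat_mono floor_mono mult_left_mono) auto
    moreover have "Y K 0 \<omega> = Y K 0 \<omega>'" by (intro Y) simp
    ultimately show "\<phi> (\<chi> i. if i = Min UNIV then walk_Z Y n K (t i) \<omega> else walk_dZ Y n K (t i) \<omega>)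
        = \<phi> (\<chi> i. if i = Min UNIV then walk_Z Y n K (t i) \<omega>' else walk_dZ Y n K (t i) \<omega>')"
      by (intro arg_cong[where f = \<phi>]) (simp add: vec_eq_iff walk_Z_def walk_dZ_def walk_X_def)
  qed
qed

lemma sum_level_term:
  "(LINT \<omega>|M. \<phi> (\<chi> i. if i = Min UNIV then walk_Z Y n K (t i) \<omega> else walk_dZ Y n K (t i) \<omega>))
    = (\<Sum>j\<le>K. level_term M Y n K t \<phi> j)"
proof -
  from walk K obtain C where "uniform_hypercube_walk M K (Y K) C"
    by (rule hypercube_walk_imp_uniform_hypercube_walk)
  then interpret uniform_hypercube_walk M K "Y K" C .
  show ?thesis
    unfolding level_term_def X_def[symmetric] by (rule expectation_levels[OF walk_vector_integrable])
qed

text \<open>The coordinate \<open>Min UNIV\<close> is the rescaled position at the first time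
  itself, not an increment. The support of \<open>\<phi>\<close> hence confines the walk at that
  time, which is the premise of \<open>level_tail_bound\<close>.\<close>

lemma level_term_tail:
  assumes half: "(1 - 2 / real K) ^ nat \<lfloor>real n * t (Min UNIV)\<rfloor> \<ge> 1 / 2"
    and supp: "\<And>x. \<bar>x $ Min UNIV\<bar> > R \<Longrightarrow> \<phi> x = 0"
  shows "\<bar>level_term M Y n K t \<phi> j\<bar> * (1 + (2 * real j - real K)\<^sup>2 / real n)
    \<le> B * (1 + 8 * R\<^sup>2 + 32 * T) * (real (K choose j) / 2 ^ K)"
proof -
  from walk K obtain C where "uniform_hypercube_walk M K (Y K) C"
    by (rule hypercube_walk_imp_uniform_hypercube_walk)
  then interpret uniform_hypercube_walk M K "Y K" C .
  have B: "B \<ge> 0" using \<phi>(2)[of 0] by simp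
  show ?thesis
    unfolding level_term_def X_def[symmetric] level_prob_eq[symmetric]
  proof (rule level_tail_bound[OF _ real_nat_floor_le[OF t] half walk_vector_integrable _ B])
    fix \<omega>
    let ?v = "\<chi> i. if i = Min UNIV then walk_Z Y n K (t i) \<omega> else walk_dZ Y n K (t i) \<omega>"
    have v: "?v $ Min UNIV = X (nat \<lfloor>real n * t (Min UNIV)\<rfloor>) \<omega> / sqrt (real n)"
      by (simp add: walk_Z_def walk_X_def X_def)
    show "\<bar>\<phi> ?v\<bar> \<le> B * of_bool (\<bar>X (nat \<lfloor>real n * t (Min UNIV)\<rfloor>) \<omega>\<bar> \<le> R * sqrt (real n))"
    proof (cases "\<bar>X (nat \<lfloor>real n * t (Min UNIV)\<rfloor>) \<omega>\<bar> \<le> R * sqrt (real n)")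
      case True
      then show ?thesis using \<phi>(2)[of ?v] by simp
    next
      case False
      then have "\<bar>?v $ Min UNIV\<bar> > R" unfolding v using n by (simp add: abs_divide less_divide_eq)
      then show ?thesis using supp B by simp
    qed
  qed (use n in simp)
qed

text \<open>The exchange with r = 1/sqrt(n) and the Brownian increments over intervals of length
  1/n. Over at most Tn steps the drift errors add up to order n/K and the third-order errors to
  order 1/sqrt(n), both relative to the probability of the level.\<close>

lemma level_term_approx:
  fixes N :: "'b measure" and j :: nat
  assumes BM: "standard_brownian_motion N W"
    and L: "L \<ge> 0" and reg: "\<And>S. lindeberg_regular L (\<chi> i. of_bool (i \<in> S)) \<phi>"
  defines "k \<equiv> 2 * real j - real K"
  shows "\<bar>level_term M Y n K t \<phi> j - real (K choose j) / 2 ^ K *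
      (LINT \<omega>|N. \<phi> ((k / sqrt (real n)) *\<^sub>R axis (Min UNIV) 1 +
        (\<chi> i. 2 * (W (real (nat \<lfloor>real n * t i\<rfloor>) / real n) \<omega> - W 0 \<omega>))))\<bar>
    \<le> real (K choose j) / 2 ^ K * (T * L * (2 * (\<bar>k\<bar> / sqrt (real n) + 1 / 2 + 2 * T) * (real n / real K) + 12 / sqrt (real n)))"
proof -
  from walk K obtain C where "uniform_hypercube_walk M K (Y K) C"
    by (rule hypercube_walk_imp_uniform_hypercube_walk)
  then interpret uniform_hypercube_walk M K "Y K" C .
  interpret N: prob_space N using BM by (simp add: standard_brownian_motion_def)
  \<comment> \<open>A common horizon for all times: steps after the last relevant one have zero
    vector \<open>e j\<close>.\<close>
  define S where "S = nat \<lfloor>real n * T\<rfloor>"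
  define e :: "nat \<Rightarrow> (real, 's) vec" where "e j = (\<chi> i. of_bool (j < nat \<lfloor>real n * t i\<rfloor>))" for j
  define D where "D j \<omega> = 2 * (W (real (Suc j) / real n) \<omega> - W (real j / real n) \<omega>)" for j \<omega>
  define r where "r = 1 / sqrt (real n)"
  define b where "b = \<bar>k\<bar> + sqrt (real n) * (1 / 2 + 2 * T)"
  have T: "T \<ge> 0" using t order_trans by blast
  have S_le: "real S \<le> T * real n" unfolding S_def using T by (simp add: mult.commute)
  have S: "nat \<lfloor>real n * t i\<rfloor> \<le> S" for i
    unfolding S_def using t(2)[of i] by (intro nat_mono floor_mono mult_left_mono) auto
  have r: "r > 0" using n by (simp add: r_def)
  have D_dist: "distributed N lborel (D j) (normal_density 0 (2 * r))" for j
  proof -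
    have "distributed N lborel (\<lambda>\<omega>. W (real (Suc j) / real n) \<omega> - W (real j / real n) \<omega>)
        (normal_density 0 (sqrt (real (Suc j) / real n - real j / real n)))"
    proof -
      have "0 \<le> real j / real n" "real j / real n < real (Suc j) / real n"
        using n by (auto simp: divide_strict_right_mono)
      then show ?thesis using BM unfolding standard_brownian_motion_def by blast
    qed
    moreover have "sqrt (real (Suc j) / real n - real j / real n) = r"
      by (simp add: r_def real_sqrt_divide flip: diff_divide_distrib)
    ultimately have "distributed N lborel (\<lambda>\<omega>. W (real (Suc j) / real n) \<omega> - W (real j / real n) \<omega>)
        (normal_density 0 r)" by simp
    from N.normal_density_affine[OF this r, of 2 0] show ?thesis by (simp add: D_def[abs_def])
  qed
  have D_indep: "N.indep_vars (\<lambda>_. borel) D {..<S}"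
  proof -
    have mono: "strict_mono_on {..S} (\<lambda>j. real j / real n)"
      using n by (auto simp: strict_mono_on_def divide_strict_right_mono)
    have "N.indep_vars (\<lambda>_. borel) (\<lambda>j \<omega>. W (u (Suc j)) \<omega> - W (u j) \<omega>) {..<S}"
      if "0 \<le> u 0" "strict_mono_on {..S} u" for u :: "nat \<Rightarrow> real"
      using BM that unfolding standard_brownian_motion_def by blast
    from this[OF _ mono]
    have "N.indep_vars (\<lambda>_. borel) (\<lambda>j \<omega>. W (real (Suc j) / real n) \<omega> - W (real j / real n) \<omega>) {..<S}"
      by simp
    from N.indep_vars_compose2[OF this, of "\<lambda>_ x. 2 * x" "\<lambda>_. borel"]
    show ?thesis by (simp add: D_def[abs_def])
  qed
  have e_reg: "lindeberg_regular L (e j) \<phi>" for j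
    using reg[of "{i. j < nat \<lfloor>real n * t i\<rfloor>}"] by (simp add: e_def)
  have moment: "expectation (\<lambda>\<omega>. of_bool (X 0 \<omega> = k) * \<bar>X j \<omega>\<bar>) \<le> level_prob k * b" if "j < S" for j
    unfolding b_def using n that S_le by (intro first_moment_from_level) auto
  have sum_D: "(\<Sum>j<S. D j \<omega> *\<^sub>R e j) = (\<chi> i. 2 * (W (real (nat \<lfloor>real n * t i\<rfloor>) / real n) \<omega> - W 0 \<omega>))" for \<omega>
    unfolding vec_eq_iff
  proof
    fix i
    have "(\<Sum>j<S. D j \<omega> * of_bool (j < nat \<lfloor>real n * t i\<rfloor>)) = (\<Sum>j<nat \<lfloor>real n * t i\<rfloor>. D j \<omega>)"
      using S[of i] by (intro sum.mono_neutral_cong_right) auto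
    also have "\<dots> = 2 * (W (real (nat \<lfloor>real n * t i\<rfloor>) / real n) \<omega> - W (real 0 / real n) \<omega>)"
      unfolding D_def
      by (simp only: sum_distrib_left[symmetric] sum_lessThan_telescope[of "\<lambda>j. W (real j / real n) \<omega>"])
    finally show "(\<Sum>j<S. D j \<omega> *\<^sub>R e j) $ i
        = (\<chi> i. 2 * (W (real (nat \<lfloor>real n * t i\<rfloor>) / real n) \<omega> - W 0 \<omega>)) $ i"
      by (simp add: sum_component e_def)
  qed
  have "\<bar>expectation (\<lambda>\<omega>. of_bool (X 0 \<omega> = k) * \<phi> ((k / sqrt (real n)) *\<^sub>R axis (Min UNIV) 1
        + (\<Sum>j<S. ((X (Suc j) \<omega> - X j \<omega>) * r) *\<^sub>R e j)))
      - level_prob k * (LINT \<omega>|N. \<phi> ((k / sqrt (real n)) *\<^sub>R axis (Min UNIV) 1 + (\<Sum>j<S. D j \<omega> *\<^sub>R e j)))\<bar>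
    \<le> level_prob k * (real S * (2 * L * r * b / real K + 12 * L * r ^ 3))"
    by (rule lindeberg_from_level[OF N.prob_space_axioms D_indep D_dist r L \<phi> e_reg moment])
  also have "expectation (\<lambda>\<omega>. of_bool (X 0 \<omega> = k) * \<phi> ((k / sqrt (real n)) *\<^sub>R axis (Min UNIV) 1
        + (\<Sum>j<S. ((X (Suc j) \<omega> - X j \<omega>) * r) *\<^sub>R e j))) = level_term M Y n K t \<phi> j"
    unfolding level_term_def X_def[symmetric] k_def[symmetric]
  proof (rule Bochner_Integration.integral_cong[OF refl])
    fix \<omega>
    show "of_bool (X 0 \<omega> = k) * \<phi> ((k / sqrt (real n)) *\<^sub>R axis (Min UNIV) 1
        + (\<Sum>j<S. ((X (Suc j) \<omega> - X j \<omega>) * r) *\<^sub>R e j)) = of_bool (X 0 \<omega> = k) *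
          \<phi> (\<chi> i. if i = Min UNIV then walk_Z Y n K (t i) \<omega> else walk_dZ Y n K (t i) \<omega>)"
      unfolding walk_vector_eq[of Y, OF refl S] r_def e_def by (cases "X 0 \<omega> = k") auto
  qed
  also have "level_prob k * (real S * (2 * L * r * b / real K + 12 * L * r ^ 3))
      \<le> level_prob k * ((T * real n) * (2 * L * r * b / real K + 12 * L * r ^ 3))"
    using r L T by (intro mult_left_mono mult_right_mono S_le level_prob_nonneg) (auto simp: b_def)
  also have "(T * real n) * (2 * L * r * b / real K + 12 * L * r ^ 3)
      = T * L * (2 * (\<bar>k\<bar> / sqrt (real n) + 1 / 2 + 2 * T) * (real n / real K) + 12 / sqrt (real n))"
  proof -
    have rb: "r * b = \<bar>k\<bar> / sqrt (real n) + 1 / 2 + 2 * T"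
      using n by (simp add: r_def b_def field_simps)
    have r3: "real n * r ^ 3 = 1 / sqrt (real n)"
      using n by (simp add: r_def power3_eq_cube field_simps)
    have "(T * real n) * (2 * L * r * b / real K + 12 * L * r ^ 3)
        = T * L * (2 * (r * b) * (real n / real K) + 12 * (real n * r ^ 3))"
      by (simp add: algebra_simps)
    then show ?thesis unfolding rb r3 by simp
  qed
  finally show ?thesis unfolding sum_D unfolding k_def level_prob_eq .
qed

end

text \<open>The directions met in the exchange are indicator vectors of subsets of the finite index
  type. There are finitely many of them, so one constant serves all steps and all
  \<open>n\<close>.\<close>

lemma smooth_compact_support_regular_subsets:
  fixes \<phi> :: "(real, 's::finite) vec \<Rightarrow> real"
  assumes "smooth_compact_support \<phi>"
  obtains L where "L \<ge> 0" "\<And>S. lindeberg_regular L (\<chi> i. of_bool (i \<in> S)) \<phi>"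
proof -
  have "\<exists>L\<ge>0. lindeberg_regular L (\<chi> i. of_bool (i \<in> S)) \<phi>" for S :: "'s set"
    using smooth_compact_support_lindeberg_regular[OF assms] by blast
  then obtain l where l: "\<And>S. l S \<ge> 0" "\<And>S :: 's set. lindeberg_regular (l S) (\<chi> i. of_bool (i \<in> S)) \<phi>"
    by metis
  show thesis
  proof (rule that[of "\<Sum>S\<in>UNIV. l S"])
    show "lindeberg_regular (\<Sum>S\<in>UNIV. l S) (\<chi> i. of_bool (i \<in> S)) \<phi>" for S
      by (rule lindeberg_regular_mono[OF l(2)]) (rule member_le_sum, auto simp: l(1))
  qed (simp add: sum_nonneg l(1))
qed

lemma integrable_inverse_1_plus_square_lborel: "integrable lborel (\<lambda>x::real. inverse (1 + x\<^sup>2))"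
  using integrable_inverse_1_plus_square by (simp add: set_integrable_def)

lemma tendsto_divide_sqrt_0: "(\<lambda>n. c / sqrt (real n)) \<longlonglongrightarrow> 0"
proof -
  have "filterlim (\<lambda>n. sqrt (real n)) at_top sequentially"
    by (intro filterlim_compose[OF sqrt_at_top] filterlim_real_sequentially)
  then show ?thesis by (intro tendsto_divide_0[OF tendsto_const] filterlim_at_top_imp_at_infinity)
qed

text \<open>The finite linear order \<open>'s\<close> plays the role of the index set 1,...,s; types
  are nonempty, which encodes s >= 1, and \<open>Min UNIV\<close> is the index of the first
  time.\<close>

theorem theorem4:
  fixes K :: "nat \<Rightarrow> nat"
    and M :: "nat \<Rightarrow> 'a measure"
    and Y :: "nat \<Rightarrow> nat \<Rightarrow> 'a \<Rightarrow> (nat \<Rightarrow> real)"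
    and N :: "'b measure"
    and W :: "real \<Rightarrow> 'b \<Rightarrow> real"
    and t :: "'s::{finite,linorder} \<Rightarrow> real"
    and \<phi> :: "(real, 's::{finite,linorder}) vec \<Rightarrow> real"
  assumes K_pos: "\<And>n. K n \<ge> 1"
    and K_lim: "filterlim K at_top sequentially"
    and nK_lim: "(\<lambda>n. real n / real (K n)) \<longlonglongrightarrow> 0"
    and walk: "\<And>k. k \<ge> 1 \<Longrightarrow>
                 hypercube_walk (M k) k (uniform_count_measure (hypercube k)) (Y k)"
    and BM: "standard_brownian_motion N W"
    and t_nonneg: "\<And>i. 0 \<le> t i"
    and t_mono: "strict_mono t"
    and \<phi>: "smooth_compact_support \<phi>"
  shows "(\<lambda>n. sqrt (2 * pi * (real (K n) / real n)) *
              (LINT \<omega>|M (K n). \<phi> (\<chi> i. if i = Min UNIV then walk_Z Y n (K n) (t i) \<omega>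
                                        else walk_dZ Y n (K n) (t i) \<omega>)))
         \<longlonglongrightarrow> (LINT x|lborel. (LINT \<omega>|N. \<phi> (\<chi> i. if i = Min UNIV then x else 2 * W (t i) \<omega>)))"
proof -
  define i0 :: 's where "i0 = Min UNIV"
  have N: "prob_space N" using BM by (simp add: standard_brownian_motion_def)
  have \<phi>_cont: "continuous_on UNIV \<phi>"
    using \<phi> unfolding smooth_compact_support_def by (metis C_k.simps(1))
  then have \<phi>_meas: "\<phi> \<in> borel_measurable borel" by (rule borel_measurable_continuous_onI)
  obtain B where B: "B \<ge> 0" "\<And>x. \<bar>\<phi> x\<bar> \<le> B"
    using dir_deriv_bounded[OF \<phi>, of 0 0] by auto
  obtain R where R: "R \<ge> 0" "\<And>x. \<bar>x $ i0\<bar> > R \<Longrightarrow> \<phi> x = 0"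
  proof -
    obtain R where R: "\<And>x. x \<in> closure {x. \<phi> x \<noteq> 0} \<Longrightarrow> norm x \<le> R"
      using \<phi> unfolding smooth_compact_support_def by (metis compact_imp_bounded bounded_iff)
    show thesis
    proof (rule that[of "max R 0"])
      fix x :: "(real, 's) vec" assume "\<bar>x $ i0\<bar> > max R 0"
      moreover have "\<bar>x $ i0\<bar> \<le> norm x" by (rule component_le_norm_cart)
      ultimately have "\<not> norm x \<le> R" by simp
      then show "\<phi> x = 0" using R[of x] closure_subset[of "{x. \<phi> x \<noteq> 0}"] by auto
    qed simp
  qed
  obtain L where L: "L \<ge> 0" "\<And>S. lindeberg_regular L (\<chi> i. of_bool (i \<in> S)) \<phi>"
    using smooth_compact_support_regular_subsets[OF \<phi>] by blast
  define T where "T = (\<Sum>i\<in>UNIV. t i)"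
  have T: "t i \<le> T" for i
    unfolding T_def by (rule member_le_sum) (auto simp: t_nonneg)
  have T0: "T \<ge> 0" unfolding T_def by (simp add: sum_nonneg t_nonneg)
  obtain c0 where c0: "c0 > 0" "\<And>K j. sqrt (2 * pi * real K) / 2 * (real (K choose j) / 2 ^ K) \<le> c0"
    using binomial_local_bound by blast

  \<comment> \<open>Multiplied by the cell width 2/sqrt(n), this normalisation gives the prefactor
    of the theorem; without that width it is the one of the local limit theorem, so the weights tend
    to 1.\<close>
  define c where "c n j = sqrt (2 * pi * real (K n)) / 2 * level_term (M (K n)) Y n (K n) t \<phi> j" for n j
  define G where "G n x = (\<Sum>j\<le>K n. c n j * indicator {(2 * real j - real (K n)) / sqrt (real n)
      ..< (2 * real j + 2 - real (K n)) / sqrt (real n)} x)" for n x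
  define J where "J n x = \<lfloor>(x * sqrt (real n) + real (K n)) / 2\<rfloor>" for n x
  define h where "h x = (LINT \<omega>|N. \<phi> (x *\<^sub>R axis i0 1 + (\<chi> i. 2 * W (t i) \<omega>)))" for x
  \<comment> \<open>\<open>c0\<close> bounds the normalised binomial weights, the inner bracket is
    the tail constant, and 9 pays for passing from the left end of a cell to an arbitrary point of
    it.\<close>
  define A where "A = 9 * (c0 * (B * (1 + 8 * R\<^sup>2 + 32 * T)))"
  define good where "good n \<longleftrightarrow> n \<ge> 1 \<and> (1 - 2 / real (K n)) ^ nat \<lfloor>real n * t (Min UNIV)\<rfloor> \<ge> 1 / 2" for n
  note walk' = walk[OF K_pos]

  have G_integral: "(LINT x|lborel. G n x) = sqrt (2 * pi * (real (K n) / real n)) *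
      (LINT \<omega>|M (K n). \<phi> (\<chi> i. if i = Min UNIV then walk_Z Y n (K n) (t i) \<omega>
                                 else walk_dZ Y n (K n) (t i) \<omega>))" if n: "n \<ge> 1" for n
  proof -
    have "(LINT x|lborel. G n x) = 2 / sqrt (real n) * (\<Sum>j\<le>K n. c n j)"
      unfolding G_def using n by (intro step_function_integral(1)) auto
    also have "\<dots> = sqrt (2 * pi * real (K n)) / sqrt (real n) * (\<Sum>j\<le>K n. level_term (M (K n)) Y n (K n) t \<phi> j)"
      unfolding c_def sum_distrib_left[symmetric] by simp
    also have "sqrt (2 * pi * real (K n)) / sqrt (real n) = sqrt (2 * pi * (real (K n) / real n))"
      by (simp flip: real_sqrt_divide)
    finally show ?thesis
      unfolding sum_level_term[where M = "M (K n)" and Y = Y and K = "K n" and n = n and t = t and \<phi> = \<phi> and T = T and B = B,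
          OF walk' K_pos n t_nonneg T \<phi>_meas B(2)] .
  qed
  have G_eval: "G n x = (if 0 \<le> J n x \<and> J n x \<le> int (K n) then c n (nat (J n x)) else 0)" if "n \<ge> 1" for n x
    unfolding G_def J_def using that by (intro step_function_integral(2)) auto
  have J_bound: "\<bar>(2 * real (nat (J n x)) - real (K n)) / sqrt (real n) - x\<bar> \<le> 2 / sqrt (real n)"
    if "n \<ge> 1" "0 \<le> J n x" for n x
  proof -
    have *: "\<bar>2 * j - k - a\<bar> \<le> 2" if "j \<le> (a + k) / 2" "(a + k) / 2 < j + 1" for j k a :: real
      using that by (simp add: abs_le_iff field_simps)
    have "real_of_int (J n x) \<le> (x * sqrt (real n) + real (K n)) / 2"
      "(x * sqrt (real n) + real (K n)) / 2 < real_of_int (J n x) + 1"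
      unfolding J_def by linarith+
    moreover have "real (nat (J n x)) = real_of_int (J n x)" using that by simp
    ultimately have "\<bar>(2 * real (nat (J n x)) - real (K n)) - x * sqrt (real n)\<bar> \<le> 2"
      by (intro *) simp_all
    moreover have "(2 * real (nat (J n x)) - real (K n)) / sqrt (real n) - x
        = ((2 * real (nat (J n x)) - real (K n)) - x * sqrt (real n)) / sqrt (real n)"
      using that by (subst diff_divide_distrib[of _ "x * sqrt (real n)"]) simp
    ultimately show ?thesis by (simp only: abs_divide) (simp add: divide_right_mono)
  qed
  have J_bound2: "\<bar>(2 * real (nat (J n x)) - real (K n)) / sqrt (real n) - x\<bar> \<le> 2"
    if "n \<ge> 1" "0 \<le> J n x" for n x
  proof -
    have "2 / sqrt (real n) \<le> 2" using that by (simp add: divide_le_eq)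
    then show ?thesis using J_bound[OF that] by linarith
  qed

  have G_bound: "\<bar>G n x\<bar> \<le> A * inverse (1 + x\<^sup>2)" if "good n" for n x
  proof (cases "0 \<le> J n x \<and> J n x \<le> int (K n)")
    case True
    have n: "n \<ge> 1" and half: "(1 - 2 / real (K n)) ^ nat \<lfloor>real n * t (Min UNIV)\<rfloor> \<ge> 1 / 2"
      using that by (auto simp: good_def)
    define j where "j = nat (J n x)"
    define y where "y = (2 * real j - real (K n)) / sqrt (real n)"
    have y2: "y\<^sup>2 = (2 * real j - real (K n))\<^sup>2 / real n"
      by (simp add: y_def power_divide)
    have "\<bar>y - x\<bar> \<le> 2" unfolding y_def j_def using True by (intro J_bound2 n) simp
    \<comment> \<open>A cell has width at most 2 for \<open>n \<ge> 1\<close>. Squaring gives x^2 <=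
      2y^2 + 8, whence the factor 9 between 1 + x^2 and 1 + y^2.\<close>
    then have "\<bar>x\<bar> \<le> \<bar>y\<bar> + 2" by arith
    then have "\<bar>x\<bar>\<^sup>2 \<le> (\<bar>y\<bar> + 2)\<^sup>2" by (intro power_mono) auto
    also have "\<dots> \<le> 2 * y\<^sup>2 + 8"
      using zero_le_power2[of "\<bar>y\<bar> - 2"] by (simp add: power2_eq_square algebra_simps)
    also have "\<dots> \<le> 9 * y\<^sup>2 + 8" by simp
    finally have x: "1 + x\<^sup>2 \<le> 9 * (1 + y\<^sup>2)" by simp
    have "\<bar>c n j\<bar> * (1 + y\<^sup>2) = sqrt (2 * pi * real (K n)) / 2 *
        (\<bar>level_term (M (K n)) Y n (K n) t \<phi> j\<bar> * (1 + (2 * real j - real (K n))\<^sup>2 / real n))"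
      by (simp add: c_def abs_mult y2)
    also have "\<dots> \<le> sqrt (2 * pi * real (K n)) / 2 *
        (B * (1 + 8 * R\<^sup>2 + 32 * T) * (real (K n choose j) / 2 ^ K n))"
      by (intro mult_left_mono level_term_tail[where M = "M (K n)" and Y = Y and K = "K n" and n = n and t = t and \<phi> = \<phi> and T = T and B = B,
          OF walk' K_pos n t_nonneg T \<phi>_meas B(2) half])
        (auto intro: R(2)[unfolded i0_def])
    also have "\<dots> = (sqrt (2 * pi * real (K n)) / 2 * (real (K n choose j) / 2 ^ K n))
        * (B * (1 + 8 * R\<^sup>2 + 32 * T))"
      by simp
    also have "\<dots> \<le> c0 * (B * (1 + 8 * R\<^sup>2 + 32 * T))"
      using B(1) T0 by (intro mult_right_mono c0 mult_nonneg_nonneg) auto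
    finally have c: "\<bar>c n j\<bar> * (1 + y\<^sup>2) \<le> c0 * (B * (1 + 8 * R\<^sup>2 + 32 * T))" .
    have "\<bar>c n j\<bar> * (1 + x\<^sup>2) \<le> \<bar>c n j\<bar> * (9 * (1 + y\<^sup>2))"
      by (intro mult_left_mono x) auto
    also have "\<dots> = 9 * (\<bar>c n j\<bar> * (1 + y\<^sup>2))" by simp
    also have "\<dots> \<le> A" unfolding A_def using c by (intro mult_left_mono) auto
    finally have "\<bar>c n j\<bar> \<le> A / (1 + x\<^sup>2)"
      by (simp add: pos_le_divide_eq add_pos_nonneg)
    then show ?thesis using G_eval[OF n, of x] True by (simp add: j_def divide_inverse)
  next
    case False
    have "A \<ge> 0" using c0(1) B(1) T0 by (simp add: A_def)
    then show ?thesis using G_eval[of n x] that False by (simp add: good_def)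
  qed

  have ev_good: "\<forall>\<^sub>F n in sequentially. good n"
  proof -
    have "(\<lambda>n. T * (real n / real (K n))) \<longlonglongrightarrow> T * 0" by (intro tendsto_intros nK_lim)
    then have "\<forall>\<^sub>F n in sequentially. T * (real n / real (K n)) < 1 / 4"
      by (rule order_tendstoD) simp
    moreover have "\<forall>\<^sub>F n in sequentially. K n \<ge> 2" using K_lim by (simp add: filterlim_at_top)
    ultimately show ?thesis using eventually_ge_at_top[of 1]
    proof eventually_elim
      case (elim n)
      let ?m = "nat \<lfloor>real n * t (Min UNIV)\<rfloor>"
      have "real ?m \<le> T * real n" by (rule real_nat_floor_le[OF t_nonneg T])
      then have "real ?m / real (K n) \<le> T * real n / real (K n)" by (intro divide_right_mono) auto
      also have "\<dots> = T * (real n / real (K n))" by simp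
      finally have "real ?m / real (K n) < 1 / 4" using elim(1) by (rule order_le_less_trans)
      moreover have "real ?m * (- 2 / real (K n)) = - 2 * (real ?m / real (K n))" by simp
      \<comment> \<open>Bernoulli's inequality transfers this to the power; it needs
        \<open>-2 / real (K n) \<ge> -1\<close>, hence the requirement
        \<open>K n \<ge> 2\<close>.\<close>
      ultimately have "1 / 2 \<le> 1 + real ?m * (- 2 / real (K n))" by linarith
      also have "\<dots> \<le> (1 + (- 2 / real (K n))) ^ ?m"
        using elim(2) by (intro Bernoulli_inequality) (simp add: field_simps)
      finally show ?case using elim(3) by (simp add: good_def)
    qed
  qed

  have G_lim: "(\<lambda>n. G n x) \<longlonglongrightarrow> h x" for x
  proof -
    define j where "j n = nat (J n x)" for n
    define k where "k n = 2 * real (j n) - real (K n)" for n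
    define \<alpha> where "\<alpha> n = sqrt (2 * pi * real (K n)) / 2 * (real (K n choose j n) / 2 ^ K n)" for n
    define I where "I n = (LINT \<omega>|N. \<phi> ((k n / sqrt (real n)) *\<^sub>R axis i0 1 +
        (\<chi> i. 2 * (W (real (nat \<lfloor>real n * t i\<rfloor>) / real n) \<omega> - W 0 \<omega>))))" for n
    \<comment> \<open>The relative error of the exchange, with the rescaled level replaced by its
      bound |x| + 2 at the fixed point \<open>x\<close>.\<close>
    define E where "E n = T * L * (2 * ((\<bar>x\<bar> + 2) + 1 / 2 + 2 * T) * (real n / real (K n)) + 12 / sqrt (real n))" for n
    \<comment> \<open>The attainable rescaled levels fill the range of radius K/sqrt(n), which
      eventually contains \<open>x\<close> because x^2 n <= K <= K^2.\<close>
    have ev: "\<forall>\<^sub>F n in sequentially. n \<ge> 1 \<and> 0 \<le> J n x \<and> J n x \<le> int (K n)"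
    proof -
      have "(\<lambda>n. x\<^sup>2 * (real n / real (K n))) \<longlonglongrightarrow> x\<^sup>2 * 0" by (intro tendsto_intros nK_lim)
      then have "\<forall>\<^sub>F n in sequentially. x\<^sup>2 * (real n / real (K n)) < 1"
        by (rule order_tendstoD) simp
      then show ?thesis using eventually_ge_at_top[of 1]
      proof eventually_elim
        case (elim n)
        have "x\<^sup>2 * real n \<le> real (K n)" using elim(1) K_pos[of n] by (simp add: field_simps)
        also have "\<dots> \<le> (real (K n))\<^sup>2" using K_pos[of n] by (simp add: power2_eq_square)
        finally have "sqrt (x\<^sup>2 * real n) \<le> real (K n)" by (intro real_le_lsqrt) auto
        then have "\<bar>x * sqrt (real n)\<bar> \<le> real (K n)" by (simp add: real_sqrt_mult abs_mult)
        then have "0 \<le> (x * sqrt (real n) + real (K n)) / 2" "(x * sqrt (real n) + real (K n)) / 2 \<le> real (K n)"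
          by auto
        then have "0 \<le> J n x" "J n x \<le> int (K n)" unfolding J_def by linarith+
        with elim(2) show ?case by simp
      qed
    qed
    have k_lim: "(\<lambda>n. k n / sqrt (real n)) \<longlonglongrightarrow> x"
    proof (rule Lim_null_comparison[of _ "\<lambda>n. 2 / sqrt (real n)", THEN LIM_zero_cancel])
      show "\<forall>\<^sub>F n in sequentially. norm (k n / sqrt (real n) - x) \<le> 2 / sqrt (real n)"
        using ev by eventually_elim (use J_bound in \<open>simp add: k_def j_def\<close>)
    qed (rule tendsto_divide_sqrt_0)
    have k_abs: "\<forall>\<^sub>F n in sequentially. n \<ge> 1 \<and> \<bar>k n\<bar> / sqrt (real n) \<le> \<bar>x\<bar> + 2"
      using ev
    proof eventually_elim
      case (elim n)
      then have "\<bar>k n / sqrt (real n) - x\<bar> \<le> 2" using J_bound2 by (simp add: k_def j_def)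
      then have "\<bar>k n / sqrt (real n)\<bar> \<le> \<bar>x\<bar> + 2" by arith
      with elim show ?case by (simp add: abs_divide)
    qed
    have \<alpha>_lim: "\<alpha> \<longlonglongrightarrow> 1"
      unfolding \<alpha>_def
    proof (rule binomial_local_limit[OF K_lim])
      show "\<forall>\<^sub>F n in sequentially. j n \<le> K n"
        using ev by eventually_elim (auto simp: j_def nat_le_iff)
      show "(\<lambda>n. (2 * real (j n) - real (K n))\<^sup>2 / real (K n)) \<longlonglongrightarrow> 0"
      proof (rule Lim_null_comparison)
        show "\<forall>\<^sub>F n in sequentially. norm ((2 * real (j n) - real (K n))\<^sup>2 / real (K n))
            \<le> (\<bar>x\<bar> + 2)\<^sup>2 * (real n / real (K n))"
          using k_abs
        proof eventually_elim
          case (elim n)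
          have "(\<bar>k n\<bar> / sqrt (real n))\<^sup>2 \<le> (\<bar>x\<bar> + 2)\<^sup>2" using elim by (intro power_mono) auto
          then have "(k n)\<^sup>2 \<le> (\<bar>x\<bar> + 2)\<^sup>2 * real n" using elim by (simp add: power_divide divide_le_eq)
          then have "(k n)\<^sup>2 / real (K n) \<le> (\<bar>x\<bar> + 2)\<^sup>2 * real n / real (K n)" by (intro divide_right_mono) auto
          then show ?case by (simp add: k_def)
        qed
        have "(\<lambda>n. (\<bar>x\<bar> + 2)\<^sup>2 * (real n / real (K n))) \<longlonglongrightarrow> (\<bar>x\<bar> + 2)\<^sup>2 * 0"
          by (intro tendsto_intros nK_lim)
        then show "(\<lambda>n. (\<bar>x\<bar> + 2)\<^sup>2 * (real n / real (K n))) \<longlonglongrightarrow> 0" by simp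
      qed
    qed
    have I_lim: "I \<longlonglongrightarrow> h x"
      unfolding I_def h_def
      by (rule brownian_discretization_limit[OF BM t_nonneg \<phi>_cont B(2) k_lim])
    have E_lim: "E \<longlonglongrightarrow> 0"
    proof -
      have "E \<longlonglongrightarrow> T * L * (2 * ((\<bar>x\<bar> + 2) + 1 / 2 + 2 * T) * 0 + 0)"
        unfolding E_def by (intro tendsto_mult tendsto_add tendsto_const nK_lim tendsto_divide_sqrt_0)
      then show ?thesis by simp
    qed
    have "(\<lambda>n. c n (j n) - \<alpha> n * I n) \<longlonglongrightarrow> 0"
    proof (rule Lim_null_comparison)
      show "\<forall>\<^sub>F n in sequentially. norm (c n (j n) - \<alpha> n * I n) \<le> \<alpha> n * E n"
        using k_abs
      proof eventually_elim
        case (elim n)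
        then have n: "n \<ge> 1" by simp
        let ?p = "real (K n choose j n) / 2 ^ K n" and ?l = "level_term (M (K n)) Y n (K n) t \<phi> (j n)"
        have "\<bar>?l - ?p * I n\<bar> \<le> ?p * (T * L * (2 * (\<bar>k n\<bar> / sqrt (real n) + 1 / 2 + 2 * T) * (real n / real (K n)) + 12 / sqrt (real n)))"
          unfolding I_def k_def i0_def
          by (rule level_term_approx[where M = "M (K n)" and Y = Y and K = "K n" and n = n and t = t and \<phi> = \<phi> and T = T and B = B,
          OF walk' K_pos n t_nonneg T \<phi>_meas B(2) BM L])
        also have "\<dots> \<le> ?p * E n"
          unfolding E_def using elim T0 L(1)
          by (intro mult_left_mono add_mono mult_right_mono order_refl) auto
        finally have "sqrt (2 * pi * real (K n)) / 2 * \<bar>?l - ?p * I n\<bar> \<le> sqrt (2 * pi * real (K n)) / 2 * (?p * E n)"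
          by (intro mult_left_mono) auto
        also have "sqrt (2 * pi * real (K n)) / 2 * \<bar>?l - ?p * I n\<bar>
            = \<bar>sqrt (2 * pi * real (K n)) / 2 * (?l - ?p * I n)\<bar>"
          by (simp add: abs_mult)
        also have "sqrt (2 * pi * real (K n)) / 2 * (?l - ?p * I n) = c n (j n) - \<alpha> n * I n"
          by (simp add: c_def \<alpha>_def right_diff_distrib)
        finally show ?case by (simp add: \<alpha>_def)
      qed
      show "(\<lambda>n. \<alpha> n * E n) \<longlonglongrightarrow> 0" using tendsto_mult[OF \<alpha>_lim E_lim] by simp
    qed
    from tendsto_add[OF this tendsto_mult[OF \<alpha>_lim I_lim]] have "(\<lambda>n. c n (j n)) \<longlonglongrightarrow> h x" by simp
    moreover have "\<forall>\<^sub>F n in sequentially. c n (j n) = G n x"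
      using ev by eventually_elim (simp add: G_eval j_def)
    ultimately show ?thesis by (rule Lim_transform_eventually)
  qed

  \<comment> \<open>The majorant is available only for good \<open>n\<close>, whereas the dominated
    convergence theorem asks for it at every index; cutting off changes finitely many terms.\<close>
  define G' where "G' n x = (if good n then G n x else 0)" for n x
  have G'_meas: "G' n \<in> borel_measurable lborel" for n
  proof -
    have "G n \<in> borel_measurable lborel" unfolding G_def by measurable
    then show ?thesis unfolding G'_def by (cases "good n") simp_all
  qed
  have G'_lim: "(\<lambda>n. G' n x) \<longlonglongrightarrow> h x" for x
    by (rule Lim_transform_eventually[OF G_lim]) (use ev_good in \<open>eventually_elim, simp add: G'_def\<close>)
  have lim: "(\<lambda>n. LINT x|lborel. G' n x) \<longlonglongrightarrow> (LINT x|lborel. h x)"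
  proof (rule integral_dominated_convergence[where w = "\<lambda>x. A * inverse (1 + x\<^sup>2)"])
    show "h \<in> borel_measurable lborel"
      \<comment> \<open>Measurability of \<open>h\<close> comes for free, as a pointwise limit of
        step functions.\<close>
      by (rule borel_measurable_LIMSEQ_real[of _ G']) (use G'_lim G'_meas in auto)
    show "integrable lborel (\<lambda>x. A * inverse (1 + x\<^sup>2))"
      by (intro integrable_mult_right integrable_inverse_1_plus_square_lborel)
    have "A * inverse (1 + x\<^sup>2) \<ge> 0" for x :: real
      using c0(1) B(1) T0 by (simp add: A_def)
    then show "AE x in lborel. norm (G' n x) \<le> A * inverse (1 + x\<^sup>2)" for n
      using G_bound by (intro AE_I2) (simp add: G'_def)
  qed (use G'_meas G'_lim in auto)
  have limit_eq: "(LINT x|lborel. h x) = (LINT x|lborel. (LINT \<omega>|N. \<phi> (\<chi> i. if i = Min UNIV then x else 2 * W (t i) \<omega>)))"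
    unfolding h_def i0_def
  proof (rule integral_translate_coordinate[OF N \<phi>_meas _ _ R(1)])
    show "(\<lambda>\<omega>. 2 * W (t i) \<omega>) \<in> borel_measurable N" for i
      using BM t_nonneg[of i] by (auto simp: standard_brownian_motion_def)
    show "\<bar>\<phi> x\<bar> \<le> B * of_bool (\<bar>x $ Min UNIV\<bar> \<le> R)" for x
      using B R(2)[of x] unfolding i0_def by (cases "\<bar>x $ Min UNIV\<bar> \<le> R") auto
  qed
  have ev_eq: "\<forall>\<^sub>F n in sequentially. (LINT x|lborel. G' n x) = sqrt (2 * pi * (real (K n) / real n)) *
              (LINT \<omega>|M (K n). \<phi> (\<chi> i. if i = Min UNIV then walk_Z Y n (K n) (t i) \<omega>
                                        else walk_dZ Y n (K n) (t i) \<omega>))"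
    using ev_good
  proof eventually_elim
    case (elim n)
    then have "G' n = G n" "n \<ge> 1" by (auto simp: G'_def good_def)
    then show ?case using G_integral by simp
  qed
  show ?thesis using Lim_transform_eventually[OF lim ev_eq] unfolding limit_eq .
qed

end
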